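(* Let $G$ be a definably compact definable group in a sufficiently saturated o-minimal expansion $M$ of a real closed field, let $\tau^G\colon G\to\lambda(G)=G/G^{00}$ be the projection, and let $\tau^G_*\colon\Pi^{\mathrm{def}}(G,G)\to\Pi(\lambda(G),\lambda(G))$ be the groupoid morphism described in the context. Then $\tau^G_*$ is $G$-equivariant: for every $x\in G$ and every $[a]\in\Pi^{\mathrm{def}}(G,G)$, $\tau^G_*(x\cdot[a])=\tau^G(x)\cdot\tau^G_*([a])$.
   Context: A definable group carries its natural definable manifold group topology; definable paths are continuous for it. $G^{00}$ is the smallest type-definable subgroup of $G$ of bounded index (it is normal), and $\lambda(G)=G/G^{00}$ with the logic topology (a set is closed iff its preimage in $G$ is type-definable) is a compact real Lie group. $\Pi^{\mathrm{def}}(G,G)$ is the groupoid of definable paths in $G$ modulo definable homotopy relative to endpoints (composition = concatenation); $\Pi(\lambda(G),\lambda(G))$ is the classical fundamental groupoid. $\tau^G_*$ is the unique groupoid morphism that equals $\tau^G$ on objects and such that for every open $O\subseteq\lambda(G)$ and every definable path $a$ with image in $(\tau^G)^{-1}(O)$ there is a path $b$ with image in $O$ and $\tau^G_*([a])=[b]$. $G$ acts on $\Pi^{\mathrm{def}}(G,G)$ by $x\cdot[a]=[x\cdot a]$ (pointwise left translation of paths) and $\lambda(G)$ acts on $\Pi(\lambda(G),\lambda(G))$ by $y\cdot[b]=[y\cdot b]$. *)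

theory Defs
  imports "HOL-Analysis.Analysis" "HOL-Algebra.Coset"
begin

unbundle cardinal_syntax

section \<open>O-minimal expansions of real closed fields\<close>

class real_closed_field = linordered_field +
  assumes nonneg_square: "0 \<le> a \<Longrightarrow> \<exists>b. a = b * b"
    and odd_degree_root: "odd n \<Longrightarrow> c n \<noteq> 0 \<Longrightarrow> \<exists>x. (\<Sum>k\<le>n. c k * x ^ k) = 0"

text \<open>
  First-order formulas, with de Bruijn indices, in a language expanding that of ordered rings by
  function symbols of type \<^typ>\<open>'f\<close> and relation symbols of type \<^typ>\<open>'r\<close>. Symbols are applied to
  lists of arbitrary length, so each of them stands for one symbol of every arity; this does not
  change the cardinality of the set of formulas.
\<close>

datatype 'f tm =
    Var nat
  | Zero
  | One
  | Plus "'f tm" "'f tm"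
  | Minus "'f tm"
  | Times "'f tm" "'f tm"
  | Fn 'f "'f tm list"

datatype ('f, 'r) fm =
    Eq "'f tm" "'f tm"
  | Less "'f tm" "'f tm"
  | Rel 'r "'f tm list"
  | Neg "('f, 'r) fm"
  | Conj "('f, 'r) fm" "('f, 'r) fm"
  | Ex "('f, 'r) fm"

text \<open>
  An expansion of an ordered field interprets only the additional symbols; the field operations
  and the order are those of the type \<^typ>\<open>'a\<close>, which is the universe.
\<close>

record ('a, 'f, 'r) expansion =
  fn :: "'f \<Rightarrow> 'a list \<Rightarrow> 'a"
  rel :: "'r \<Rightarrow> 'a list \<Rightarrow> bool"

text \<open>
  Variable \<open>i\<close> is read at position \<open>i\<close> of the list. Variables beyond the end of the list
  are read as \<open>0\<close>: as \<open>0\<close> is named by a constant, this defines the same sets as formulas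
  whose free variables are all in range.
\<close>

definition lookup :: "'a::zero list \<Rightarrow> nat \<Rightarrow> 'a" where
  "lookup zs i = (if i < length zs then zs ! i else 0)"

primrec eval :: "('a::linordered_field, 'f, 'r) expansion \<Rightarrow> 'a list \<Rightarrow> 'f tm \<Rightarrow> 'a" where
  "eval M zs (Var i) = lookup zs i"
| "eval M zs Zero = 0"
| "eval M zs One = 1"
| "eval M zs (Plus s t) = eval M zs s + eval M zs t"
| "eval M zs (Minus t) = - eval M zs t"
| "eval M zs (Times s t) = eval M zs s * eval M zs t"
| "eval M zs (Fn f ts) = fn M f (map (eval M zs) ts)"

primrec sat :: "('a::linordered_field, 'f, 'r) expansion \<Rightarrow> 'a list \<Rightarrow> ('f, 'r) fm \<Rightarrow> bool" where
  "sat M zs (Eq s t) \<longleftrightarrow> eval M zs s = eval M zs t"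
| "sat M zs (Less s t) \<longleftrightarrow> eval M zs s < eval M zs t"
| "sat M zs (Rel r ts) \<longleftrightarrow> rel M r (map (eval M zs) ts)"
| "sat M zs (Neg p) \<longleftrightarrow> \<not> sat M zs p"
| "sat M zs (Conj p q) \<longleftrightarrow> sat M zs p \<and> sat M zs q"
| "sat M zs (Ex p) \<longleftrightarrow> (\<exists>x. sat M (x # zs) p)"

text \<open>Points of \<open>M\<close>\<open>\<^sup>n\<close> are lists of length \<open>n\<close>.\<close>

definition cart :: "nat \<Rightarrow> 'a list set" where
  "cart n = {xs. length xs = n}"

text \<open>Definability is always with parameters (the list \<open>ps\<close>) from the structure.\<close>

definition definable :: "('a::linordered_field, 'f, 'r) expansion \<Rightarrow> nat \<Rightarrow> 'a list set \<Rightarrow> bool" where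
  "definable M n X \<longleftrightarrow> (\<exists>(p :: ('f, 'r) fm) ps. X = {xs \<in> cart n. sat M (xs @ ps) p})"

definition definable_map ::
  "('a::linordered_field, 'f, 'r) expansion \<Rightarrow> nat \<Rightarrow> nat \<Rightarrow> 'a list set \<Rightarrow> 'a list set
    \<Rightarrow> ('a list \<Rightarrow> 'a list) \<Rightarrow> bool" where
  "definable_map M m n X Y f \<longleftrightarrow>
     X \<subseteq> cart m \<and> Y \<subseteq> cart n \<and> f \<in> X \<rightarrow> Y \<and> definable M (m + n) {x @ f x | x. x \<in> X}"

definition o_minimal :: "('a::linordered_field, 'f, 'r) expansion \<Rightarrow> bool" where
  "o_minimal M \<longleftrightarrow>
     (\<forall>X. definable M 1 X \<longrightarrow>
        (\<exists>\<I>. finite \<I> \<and> hd ` X = \<Union>\<I> \<and>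
           (\<forall>I\<in>\<I>. I = UNIV \<or> (\<exists>a. I = {a} \<or> I = {..<a} \<or> I = {a<..}) \<or>
                  (\<exists>a b. I = {a<..<b}))))"

definition saturated :: "'k rel \<Rightarrow> ('a::linordered_field, 'f, 'r) expansion \<Rightarrow> bool" where
  "saturated \<kappa> M \<longleftrightarrow>
     (\<forall>(A :: 'a set) (\<Sigma> :: (('f, 'r) fm \<times> 'a list) set).
        |A| <o \<kappa> \<longrightarrow> (\<forall>(p, ps)\<in>\<Sigma>. set ps \<subseteq> A) \<longrightarrow>
        (\<forall>\<Sigma>\<^sub>0 \<subseteq> \<Sigma>. finite \<Sigma>\<^sub>0 \<longrightarrow> (\<exists>x. \<forall>(p, ps)\<in>\<Sigma>\<^sub>0. sat M (x # ps) p)) \<longrightarrow>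
        (\<exists>x. \<forall>(p, ps)\<in>\<Sigma>. sat M (x # ps) p))"

text \<open>
  The cardinal \<open>\<kappa>\<close> is part of the data: ``small'' and ``bounded'' mean of cardinality
  less than \<open>\<kappa>\<close>. It is regular and larger than two to the number of formulas.
\<close>

definition sufficiently_saturated ::
  "'k rel \<Rightarrow> ('a::linordered_field, 'f, 'r) expansion \<Rightarrow> bool" where
  "sufficiently_saturated \<kappa> M \<longleftrightarrow>
     Cinfinite \<kappa> \<and> regularCard \<kappa> \<and> |Pow (UNIV :: ('f, 'r) fm set)| <o \<kappa> \<and> saturated \<kappa> M"

definition type_definable ::
  "'k rel \<Rightarrow> ('a::linordered_field, 'f, 'r) expansion \<Rightarrow> nat \<Rightarrow> 'a list set \<Rightarrow> bool" where
  "type_definable \<kappa> M n X \<longleftrightarrow>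
     (\<exists>\<D>. |\<D>| <o \<kappa> \<and> (\<forall>D\<in>\<D>. definable M n D) \<and> X = cart n \<inter> \<Inter>\<D>)"

section \<open>Definable groups and their topology\<close>

definition box_topology :: "nat \<Rightarrow> 'a::linordered_field list topology" where
  "box_topology n =
     topology (\<lambda>U. U \<subseteq> cart n \<and>
       (\<forall>x\<in>U. \<exists>e>0. \<forall>y\<in>cart n. (\<forall>i<n. \<bar>y ! i - x ! i\<bar> < e) \<longrightarrow> y \<in> U))"

lemma openin_box_topology:
  "openin (box_topology n) U \<longleftrightarrow>
     U \<subseteq> cart n \<and> (\<forall>x\<in>U. \<exists>e>0. \<forall>y\<in>cart n. (\<forall>i<n. \<bar>y ! i - x ! i\<bar> < e) \<longrightarrow> y \<in> U)"
    (is "_ \<longleftrightarrow> ?P U")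
proof -
  have "istopology ?P"
    unfolding istopology_def
  proof (intro conjI allI impI)
    fix S T assume S: "?P S" and T: "?P T"
    then show "S \<inter> T \<subseteq> cart n" by blast
    show "\<forall>x\<in>S \<inter> T. \<exists>e>0. \<forall>y\<in>cart n. (\<forall>i<n. \<bar>y ! i - x ! i\<bar> < e) \<longrightarrow> y \<in> S \<inter> T"
    proof
      fix x assume x: "x \<in> S \<inter> T"
      obtain d where d: "d > 0" "\<forall>y\<in>cart n. (\<forall>i<n. \<bar>y ! i - x ! i\<bar> < d) \<longrightarrow> y \<in> S" using S x by blast
      obtain e where e: "e > 0" "\<forall>y\<in>cart n. (\<forall>i<n. \<bar>y ! i - x ! i\<bar> < e) \<longrightarrow> y \<in> T" using T x by blast
      show "\<exists>e>0. \<forall>y\<in>cart n. (\<forall>i<n. \<bar>y ! i - x ! i\<bar> < e) \<longrightarrow> y \<in> S \<inter> T"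
        using d e by (intro exI[of _ "min d e"]) auto
    qed
  next
    fix \<K> assume *: "\<forall>K\<in>\<K>. ?P K"
    then show "\<Union>\<K> \<subseteq> cart n" by blast
    show "\<forall>x\<in>\<Union>\<K>. \<exists>e>0. \<forall>y\<in>cart n. (\<forall>i<n. \<bar>y ! i - x ! i\<bar> < e) \<longrightarrow> y \<in> \<Union>\<K>"
      using * by (metis Union_iff)
  qed
  then show ?thesis unfolding box_topology_def by simp
qed

definition definable_group ::
  "('a::linordered_field, 'f, 'r) expansion \<Rightarrow> nat \<Rightarrow> 'a list monoid \<Rightarrow> bool" where
  "definable_group M n G \<longleftrightarrow>
     group G \<and> definable M n (carrier G) \<and>
     definable M (3 * n) {x @ y @ (x \<otimes>\<^bsub>G\<^esub> y) | x y. x \<in> carrier G \<and> y \<in> carrier G}"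

text \<open>
  A topology on \<open>G\<close> that makes it a topological group and has a finite atlas of definable
  charts onto open subsets of some \<open>M\<close>\<open>\<^sup>d\<close>. By a theorem of Pillay every definable group
  has exactly one.
\<close>

definition group_manifold_topology ::
  "('a::linordered_field, 'f, 'r) expansion \<Rightarrow> nat \<Rightarrow> 'a list monoid \<Rightarrow> 'a list topology \<Rightarrow> bool" where
  "group_manifold_topology M n G T \<longleftrightarrow>
     topspace T = carrier G \<and>
     continuous_map (prod_topology T T) T (\<lambda>(x, y). x \<otimes>\<^bsub>G\<^esub> y) \<and>
     continuous_map T T (\<lambda>x. inv\<^bsub>G\<^esub> x) \<and>
     (\<exists>d (k::nat) U V \<phi>.
        (\<Union>i<k. U i) = carrier G \<and>
        (\<forall>i<k. openin T (U i) \<and> openin (box_topology d) (V i) \<and>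
               definable_map M n d (U i) (V i) (\<phi> i) \<and>
               homeomorphic_map (subtopology T (U i)) (subtopology (box_topology d) (V i)) (\<phi> i)))"

definition cube :: "nat \<Rightarrow> 'a::linordered_field list set" where
  "cube n = {xs \<in> cart n. \<forall>x\<in>set xs. 0 \<le> x \<and> x \<le> 1}"

text \<open>Every definable curve on an open interval has limits in \<open>G\<close> at both ends.\<close>

definition definably_compact ::
  "('a::linordered_field, 'f, 'r) expansion \<Rightarrow> nat \<Rightarrow> 'a list monoid \<Rightarrow> 'a list topology \<Rightarrow> bool" where
  "definably_compact M n G T \<longleftrightarrow>
     (\<forall>a b f. a < b \<longrightarrow>
        definable_map M 1 n {z \<in> cart 1. z ! 0 \<in> {a<..<b}} (carrier G) f \<longrightarrow>
        continuous_map (subtopology (box_topology 1) {z \<in> cart 1. z ! 0 \<in> {a<..<b}}) T f \<longrightarrow>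
        (\<exists>l\<in>carrier G. \<forall>U. openin T U \<and> l \<in> U \<longrightarrow> (\<exists>c\<in>{a<..<b}. \<forall>t\<in>{a<..<c}. f [t] \<in> U)) \<and>
        (\<exists>l\<in>carrier G. \<forall>U. openin T U \<and> l \<in> U \<longrightarrow> (\<exists>c\<in>{a<..<b}. \<forall>t\<in>{c<..<b}. f [t] \<in> U)))"

section \<open>The quotient by the infinitesimal subgroup\<close>

definition bounded_type_definable_subgroup ::
  "'k rel \<Rightarrow> ('a::linordered_field, 'f, 'r) expansion \<Rightarrow> nat \<Rightarrow> 'a list monoid \<Rightarrow> 'a list set \<Rightarrow> bool" where
  "bounded_type_definable_subgroup \<kappa> M n G H \<longleftrightarrow>
     subgroup H G \<and> type_definable \<kappa> M n H \<and> |rcosets\<^bsub>G\<^esub> H| <o \<kappa>"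

definition is_G00 ::
  "'k rel \<Rightarrow> ('a::linordered_field, 'f, 'r) expansion \<Rightarrow> nat \<Rightarrow> 'a list monoid \<Rightarrow> 'a list set \<Rightarrow> bool" where
  "is_G00 \<kappa> M n G H \<longleftrightarrow>
     bounded_type_definable_subgroup \<kappa> M n G H \<and>
     (\<forall>K. bounded_type_definable_subgroup \<kappa> M n G K \<longrightarrow> H \<subseteq> K)"

definition quotient_proj :: "('x, 'y) monoid_scheme \<Rightarrow> 'x set \<Rightarrow> 'x \<Rightarrow> 'x set" where
  "quotient_proj G H x = H #>\<^bsub>G\<^esub> x"

definition logic_topology ::
  "'k rel \<Rightarrow> ('a::linordered_field, 'f, 'r) expansion \<Rightarrow> nat \<Rightarrow> 'a list monoid \<Rightarrow> 'a list set
    \<Rightarrow> 'a list set topology" where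
  "logic_topology \<kappa> M n G H =
     topology (\<lambda>U. U \<subseteq> carrier (G Mod H) \<and>
       type_definable \<kappa> M n {x \<in> carrier G. quotient_proj G H x \<in> carrier (G Mod H) - U})"

text \<open>The logic topology is indeed a topology; this uses that \<open>\<kappa>\<close> is regular.\<close>

primrec tren :: "(nat \<Rightarrow> nat) \<Rightarrow> 'f tm \<Rightarrow> 'f tm" where
  "tren s (Var i) = Var (s i)"
| "tren s Zero = Zero"
| "tren s One = One"
| "tren s (Plus a b) = Plus (tren s a) (tren s b)"
| "tren s (Minus a) = Minus (tren s a)"
| "tren s (Times a b) = Times (tren s a) (tren s b)"
| "tren s (Fn f ts) = Fn f (map (tren s) ts)"

primrec fren :: "(nat \<Rightarrow> nat) \<Rightarrow> ('f, 'r) fm \<Rightarrow> ('f, 'r) fm" where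
  "fren s (Eq a b) = Eq (tren s a) (tren s b)"
| "fren s (Less a b) = Less (tren s a) (tren s b)"
| "fren s (Rel r ts) = Rel r (map (tren s) ts)"
| "fren s (Neg p) = Neg (fren s p)"
| "fren s (Conj p q) = Conj (fren s p) (fren s q)"
| "fren s (Ex p) = Ex (fren (case_nat 0 (\<lambda>i. Suc (s i))) p)"

lemma eval_tren: "(\<And>i. lookup ys (s i) = lookup zs i) \<Longrightarrow> eval M ys (tren s t) = eval M zs t"
  by (induction t) (auto cong: map_cong simp: comp_def)

lemma sat_fren: "(\<And>i. lookup ys (s i) = lookup zs i) \<Longrightarrow> sat M ys (fren s p) = sat M zs p"
proof (induction p arbitrary: ys zs s)
  case (Ex p)
  have "sat M (x # ys) (fren (case_nat 0 (\<lambda>i. Suc (s i))) p) = sat M (x # zs) p" for x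
  proof (rule Ex.IH)
    fix i
    have *: "lookup (x # zs') (Suc j) = lookup zs' j" "lookup (x # zs') 0 = x" for zs' j
      by (auto simp: lookup_def)
    show "lookup (x # ys) (case_nat 0 (\<lambda>i. Suc (s i)) i) = lookup (x # zs) i"
      using Ex.prems by (cases i) (auto simp: *)
  qed
  then show ?case by simp
qed (auto simp: eval_tren cong: map_cong simp: comp_def)

lemma definable_Un:
  assumes "definable M n X" "definable M n Y" shows "definable M n (X \<union> Y)"
proof -
  obtain p ps where X: "X = {xs \<in> cart n. sat M (xs @ ps) p}" using assms unfolding definable_def by blast
  obtain q qs where Y: "Y = {xs \<in> cart n. sat M (xs @ qs) q}" using assms unfolding definable_def by blast
  define s where "s i = (if i < n + length ps then i else i + length qs)" for i
  define r where "r i = (if i < n then i else i + length ps)" for i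
  have 1: "sat M (xs @ ps @ qs) (fren s p) = sat M (xs @ ps) p" if "xs \<in> cart n" for xs
    using that by (intro sat_fren) (auto simp: lookup_def s_def nth_append cart_def)
  have 2: "sat M (xs @ ps @ qs) (fren r q) = sat M (xs @ qs) q" if "xs \<in> cart n" for xs
    using that by (intro sat_fren) (auto simp: lookup_def r_def nth_append cart_def)
  show ?thesis unfolding definable_def
    by (rule exI[of _ "Neg (Conj (Neg (fren s p)) (Neg (fren r q)))"], rule exI[of _ "ps @ qs"])
      (use 1 2 X Y in auto)
qed

lemma definable_empty: "definable M n {}"
  unfolding definable_def by (rule exI[of _ "Less Zero Zero"]) auto

lemma definable_cart: "definable M n X \<Longrightarrow> X \<subseteq> cart n"
  unfolding definable_def by auto

context
  fixes \<kappa> :: "'k rel"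
  assumes k: "Cinfinite \<kappa>" "regularCard \<kappa>"
begin

lemma finite_ordLess: "finite A \<Longrightarrow> |A| <o \<kappa>"
  using k by (intro finite_ordLess_infinite)
    (auto simp: cinfinite_def Field_card_of card_order_on_def card_of_well_order_on)

lemma type_definable_if_definable: "definable M n X \<Longrightarrow> type_definable \<kappa> M n X"
  unfolding type_definable_def using definable_cart[of M n X]
  by (intro exI[of _ "{X}"]) (auto intro: finite_ordLess)

lemma type_definable_Un: assumes "type_definable \<kappa> M n X" "type_definable \<kappa> M n Y"
  shows "type_definable \<kappa> M n (X \<union> Y)"
proof -
  obtain A where A: "|A| <o \<kappa>" "\<forall>D\<in>A. definable M n D" "X = cart n \<inter> \<Inter>A"
    using assms unfolding type_definable_def by blast
  obtain B where B: "|B| <o \<kappa>" "\<forall>D\<in>B. definable M n D" "Y = cart n \<inter> \<Inter>B"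
    using assms unfolding type_definable_def by blast
  define C where "C = (\<Union>a\<in>A. \<Union>b\<in>B. {a \<union> b})"
  have "|\<Union>b\<in>B. {a \<union> b}| <o \<kappa>" for a
    by (rule card_of_UNION_ordLess_infinite_Field_regularCard[OF k(2,1) B(1)]) (auto intro: finite_ordLess)
  then have "|C| <o \<kappa>" unfolding C_def
    by (intro card_of_UNION_ordLess_infinite_Field_regularCard[OF k(2,1) A(1)]) auto
  moreover have "\<forall>D\<in>C. definable M n D" using A B definable_Un unfolding C_def by blast
  moreover have "X \<union> Y = cart n \<inter> \<Inter>C" using A B unfolding C_def by auto
  ultimately show ?thesis unfolding type_definable_def by blast
qed

lemma type_definable_INT: assumes "\<And>i. i \<in> I \<Longrightarrow> type_definable \<kappa> M n (X i)" "|I| <o \<kappa>"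
  shows "type_definable \<kappa> M n (cart n \<inter> (\<Inter>i\<in>I. X i))"
proof -
  have "\<forall>i\<in>I. \<exists>A. |A| <o \<kappa> \<and> (\<forall>D\<in>A. definable M n D) \<and> X i = cart n \<inter> \<Inter>A"
    using assms unfolding type_definable_def by blast
  then obtain A where A: "\<forall>i\<in>I. |A i| <o \<kappa> \<and> (\<forall>D\<in>A i. definable M n D) \<and> X i = cart n \<inter> \<Inter>(A i)"
    by metis
  have "|\<Union>i\<in>I. A i| <o \<kappa>"
    by (intro card_of_UNION_ordLess_infinite_Field_regularCard[OF k(2,1) assms(2)]) (use A in auto)
  then show ?thesis unfolding type_definable_def
    by (intro exI[of _ "\<Union>i\<in>I. A i"]) (use A in auto)
qed
end

lemma openin_logic_topology:
  assumes "sufficiently_saturated \<kappa> M" "definable_group M n G" "is_G00 \<kappa> M n G H"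
  shows "openin (logic_topology \<kappa> M n G H) U \<longleftrightarrow>
     U \<subseteq> carrier (G Mod H) \<and>
       type_definable \<kappa> M n {x \<in> carrier G. quotient_proj G H x \<in> carrier (G Mod H) - U}"
    (is "_ \<longleftrightarrow> ?P U")
proof -
  have k: "Cinfinite \<kappa>" "regularCard \<kappa>" using assms(1) unfolding sufficiently_saturated_def by auto
  have idx: "|carrier (G Mod H)| <o \<kappa>"
    using assms(3) unfolding is_G00_def bounded_type_definable_subgroup_def FactGroup_def by simp
  have G: "definable M n (carrier G)" "carrier G \<subseteq> cart n"
    using assms(2) definable_cart unfolding definable_group_def by auto
  let ?q = "quotient_proj G H"
  let ?c = "\<lambda>U. {x \<in> carrier G. ?q x \<in> carrier (G Mod H) - U}"
  have q: "?q x \<in> carrier (G Mod H)" if "x \<in> carrier G" for x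
    using that unfolding quotient_proj_def FactGroup_def RCOSETS_def by auto
  have "istopology ?P"
    unfolding istopology_def
  proof (intro conjI allI impI)
    fix S T assume S: "?P S" and T: "?P T"
    then show "S \<inter> T \<subseteq> carrier (G Mod H)" by blast
    have "type_definable \<kappa> M n (?c S \<union> ?c T)"
      by (rule type_definable_Un[OF k]) (rule conjunct2[OF S] conjunct2[OF T])+
    also have "?c S \<union> ?c T = ?c (S \<inter> T)" by blast
    finally show "type_definable \<kappa> M n (?c (S \<inter> T))" .
  next
    fix \<K> assume *: "\<forall>K\<in>\<K>. ?P K"
    then show "\<Union>\<K> \<subseteq> carrier (G Mod H)" by blast
    define f where "f y = (SOME K. K \<in> \<K> \<and> y \<in> K)" for y
    have f: "f y \<in> \<K> \<and> y \<in> f y" if "y \<in> \<Union>\<K>" for y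
      unfolding f_def by (rule someI_ex) (use that in blast)
    define X where "X z = (case z of None \<Rightarrow> carrier G | Some y \<Rightarrow> ?c (f y))" for z
    define I where "I = insert None (Some ` \<Union>\<K>)"
    have "type_definable \<kappa> M n (cart n \<inter> (\<Inter>z\<in>I. X z))"
    proof (rule type_definable_INT[OF k])
      fix z assume "z \<in> I"
      then consider "z = None" | y where "z = Some y" "y \<in> \<Union>\<K>" unfolding I_def by blast
      then show "type_definable \<kappa> M n (X z)"
      proof cases
        case 1
        then show ?thesis using type_definable_if_definable[OF k G(1)] by (simp add: X_def)
      next
        case 2
        have "type_definable \<kappa> M n (?c (f y))" using f[OF 2(2)] * by blast
        then show ?thesis using 2(1) by (simp add: X_def)
      qed
    next
      have "\<Union>\<K> \<subseteq> carrier (G Mod H)" using * by blast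
      then have "|\<Union>\<K>| <o \<kappa>" by (rule ordLeq_ordLess_trans[OF card_of_mono1 idx])
      then have "|Some ` \<Union>\<K>| <o \<kappa>" by (rule ordLeq_ordLess_trans[OF card_of_image])
      moreover have "|{None}| <o \<kappa>" by (rule finite_ordLess[OF k]) simp
      ultimately have "|{None} \<union> Some ` \<Union>\<K>| <o \<kappa>"
        using k(1) by (intro card_of_Un_ordLess_infinite_Field) (auto simp: cinfinite_def)
      then show "|I| <o \<kappa>" by (simp add: I_def)
    qed
    also have "cart n \<inter> (\<Inter>z\<in>I. X z) = ?c (\<Union>\<K>)"
    proof (intro equalityI subsetI)
      fix x assume "x \<in> cart n \<inter> (\<Inter>z\<in>I. X z)"
      then have x: "\<And>z. z \<in> I \<Longrightarrow> x \<in> X z" by blast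
      have "x \<in> carrier G" using x[of None] by (simp add: I_def X_def)
      moreover have "?q x \<notin> \<Union>\<K>"
      proof
        assume y: "?q x \<in> \<Union>\<K>"
        then have "x \<in> X (Some (?q x))" by (intro x) (simp add: I_def)
        then show False using f[OF y] by (simp add: X_def)
      qed
      ultimately show "x \<in> ?c (\<Union>\<K>)" using q[of x] by simp
    next
      fix x assume x: "x \<in> ?c (\<Union>\<K>)"
      then have xG: "x \<in> carrier G" by simp
      have "x \<in> X z" if "z \<in> I" for z
      proof (cases z)
        case None
        then show ?thesis using xG by (simp add: X_def)
      next
        case (Some y)
        then have "f y \<in> \<K>" using that f[of y] unfolding I_def by blast
        then have "?q x \<notin> f y" using x by simp
        then show ?thesis using Some xG q[OF xG] by (simp add: X_def)
      qed
      moreover have "x \<in> cart n" using xG G(2) by (rule rev_subsetD)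
      ultimately show "x \<in> cart n \<inter> (\<Inter>z\<in>I. X z)" by simp
    qed
    finally show "type_definable \<kappa> M n (?c (\<Union>\<K>))" .
  qed
  then show ?thesis unfolding logic_topology_def by simp
qed

section \<open>Fundamental groupoids\<close>

text \<open>Inverses in a groupoid are determined by the remaining data.\<close>

record ('o, 'm) groupoid =
  objects :: "'o set"
  arrows :: "'m set"
  source :: "'m \<Rightarrow> 'o"
  target :: "'m \<Rightarrow> 'o"
  compose :: "'m \<Rightarrow> 'm \<Rightarrow> 'm"
  ident :: "'o \<Rightarrow> 'm"

text \<open>Composition is written in the order of concatenation of paths.\<close>

definition groupoid_morphism ::
  "('o, 'm) groupoid \<Rightarrow> ('p, 'q) groupoid \<Rightarrow> ('o \<Rightarrow> 'p) \<Rightarrow> ('m \<Rightarrow> 'q) \<Rightarrow> bool" where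
  "groupoid_morphism A B F\<^sub>0 F \<longleftrightarrow>
     F\<^sub>0 \<in> objects A \<rightarrow> objects B \<and> F \<in> arrows A \<rightarrow> arrows B \<and>
     (\<forall>f\<in>arrows A. source B (F f) = F\<^sub>0 (source A f) \<and> target B (F f) = F\<^sub>0 (target A f)) \<and>
     (\<forall>x\<in>objects A. F (ident A x) = ident B (F\<^sub>0 x)) \<and>
     (\<forall>f\<in>arrows A. \<forall>g\<in>arrows A. target A f = source A g \<longrightarrow>
        F (compose A f g) = compose B (F f) (F g))"

definition concat_paths :: "('t::linordered_field \<Rightarrow> 'x) \<Rightarrow> ('t \<Rightarrow> 'x) \<Rightarrow> 't \<Rightarrow> 'x" where
  "concat_paths a b = (\<lambda>t. if t \<le> 1 / 2 then a (2 * t) else b (2 * t - 1))"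

text \<open>
  The following notions are used both for definable paths, with parameter in \<open>M\<close>, and for
  classical ones. The relation \<open>E\<close> is homotopy relative to endpoints of paths in \<open>X\<close>; it is
  reflexive exactly on paths. Paths are total functions, but only their values on the unit
  interval are relevant: functions that agree there are homotopic.
\<close>

definition path_class :: "(('t \<Rightarrow> 'x) \<Rightarrow> ('t \<Rightarrow> 'x) \<Rightarrow> bool) \<Rightarrow> ('t \<Rightarrow> 'x) \<Rightarrow> ('t \<Rightarrow> 'x) set" where
  "path_class E a = {b. E a b}"

definition path_groupoid ::
  "'x set \<Rightarrow> (('t::linordered_field \<Rightarrow> 'x) \<Rightarrow> ('t \<Rightarrow> 'x) \<Rightarrow> bool) \<Rightarrow> ('x, ('t \<Rightarrow> 'x) set) groupoid" where
  "path_groupoid X E =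
     \<lparr>objects = X,
      arrows = {path_class E a | a. E a a},
      source = (\<lambda>c. THE x. \<forall>a\<in>c. a 0 = x),
      target = (\<lambda>c. THE x. \<forall>a\<in>c. a 1 = x),
      compose = (\<lambda>c d. \<Union>a\<in>c. \<Union>b\<in>d. path_class E (concat_paths a b)),
      ident = (\<lambda>x. path_class E (\<lambda>_. x))\<rparr>"

definition translate ::
  "('x, 'y) monoid_scheme \<Rightarrow> (('t \<Rightarrow> 'x) \<Rightarrow> ('t \<Rightarrow> 'x) \<Rightarrow> bool) \<Rightarrow> 'x \<Rightarrow> ('t \<Rightarrow> 'x) set \<Rightarrow> ('t \<Rightarrow> 'x) set" where
  "translate G E x c = (\<Union>a\<in>c. path_class E (\<lambda>t. x \<otimes>\<^bsub>G\<^esub> a t))"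

definition definable_path ::
  "('a::linordered_field, 'f, 'r) expansion \<Rightarrow> nat \<Rightarrow> 'a list topology \<Rightarrow> ('a \<Rightarrow> 'a list) \<Rightarrow> bool" where
  "definable_path M n T a \<longleftrightarrow>
     definable_map M 1 n (cube 1) (topspace T) (\<lambda>z. a (z ! 0)) \<and>
     continuous_map (subtopology (box_topology 1) (cube 1)) T (\<lambda>z. a (z ! 0))"

definition definably_homotopic ::
  "('a::linordered_field, 'f, 'r) expansion \<Rightarrow> nat \<Rightarrow> 'a list topology
    \<Rightarrow> ('a \<Rightarrow> 'a list) \<Rightarrow> ('a \<Rightarrow> 'a list) \<Rightarrow> bool" where
  "definably_homotopic M n T a b \<longleftrightarrow>
     definable_path M n T a \<and> definable_path M n T b \<and>
     (\<exists>h. definable_map M 2 n (cube 2) (topspace T) (\<lambda>z. h (z ! 0) (z ! 1)) \<and>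
          continuous_map (subtopology (box_topology 2) (cube 2)) T (\<lambda>z. h (z ! 0) (z ! 1)) \<and>
          (\<forall>t\<in>{0..1}. h 0 t = a t \<and> h 1 t = b t) \<and>
          (\<forall>s\<in>{0..1}. h s 0 = a 0 \<and> h s 1 = a 1))"

text \<open>The analogue of \<^const>\<open>homotopic_paths\<close> for abstract topologies.\<close>

definition path_homotopic :: "'x topology \<Rightarrow> (real \<Rightarrow> 'x) \<Rightarrow> (real \<Rightarrow> 'x) \<Rightarrow> bool" where
  "path_homotopic X a b \<longleftrightarrow>
     homotopic_with (\<lambda>r. r 0 = a 0 \<and> r 1 = a 1) (top_of_set {0..1}) X a b"

definition Pi_def ::
  "('a::linordered_field, 'f, 'r) expansion \<Rightarrow> nat \<Rightarrow> 'a list topology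
    \<Rightarrow> ('a list, ('a \<Rightarrow> 'a list) set) groupoid" where
  "Pi_def M n T = path_groupoid (topspace T) (definably_homotopic M n T)"

definition Pi_top :: "'x topology \<Rightarrow> ('x, (real \<Rightarrow> 'x) set) groupoid" where
  "Pi_top X = path_groupoid (topspace X) (path_homotopic X)"

section \<open>The comparison morphism\<close>

definition tau_lift ::
  "'k rel \<Rightarrow> ('a::linordered_field, 'f, 'r) expansion \<Rightarrow> nat \<Rightarrow> 'a list monoid \<Rightarrow> 'a list topology
    \<Rightarrow> 'a list set \<Rightarrow> (('a \<Rightarrow> 'a list) set \<Rightarrow> (real \<Rightarrow> 'a list set) set) \<Rightarrow> bool" where
  "tau_lift \<kappa> M n G T H F \<longleftrightarrow>
     groupoid_morphism (Pi_def M n T) (Pi_top (logic_topology \<kappa> M n G H)) (quotient_proj G H) F \<and>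
     (\<forall>U a. openin (logic_topology \<kappa> M n G H) U \<longrightarrow> definable_path M n T a \<longrightarrow>
        (\<forall>t\<in>{0..1}. quotient_proj G H (a t) \<in> U) \<longrightarrow>
        (\<exists>b. pathin (logic_topology \<kappa> M n G H) b \<and> b ` {0..1} \<subseteq> U \<and>
             F (path_class (definably_homotopic M n T) a) =
               path_class (path_homotopic (logic_topology \<kappa> M n G H)) b))"

text \<open>Uniqueness can only be asked on arrows, since \<open>F\<close> is a total function.\<close>

definition is_tau_star ::
  "'k rel \<Rightarrow> ('a::linordered_field, 'f, 'r) expansion \<Rightarrow> nat \<Rightarrow> 'a list monoid \<Rightarrow> 'a list topology
    \<Rightarrow> 'a list set \<Rightarrow> (('a \<Rightarrow> 'a list) set \<Rightarrow> (real \<Rightarrow> 'a list set) set) \<Rightarrow> bool" where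
  "is_tau_star \<kappa> M n G T H F \<longleftrightarrow>
     tau_lift \<kappa> M n G T H F \<and>
     (\<forall>F'. tau_lift \<kappa> M n G T H F' \<longrightarrow> (\<forall>c\<in>arrows (Pi_def M n T). F' c = F c))"

end

(*
  Conjugate the comparison morphism by translations: c |-> q(x)^-1 . tau_star (x . c) is again a
  groupoid morphism over q, and it has the local lifting property because left translation by
  q(x)^-1 is a homeomorphism for the logic topology. Uniqueness of tau_star makes the two morphisms
  agree on arrows, which is equivariance.
*)

theory Submission
  imports Defs
begin

text \<open>A translation moves objects, so \<open>tau_star\<close> after a translation no longer
  lies over the projection in general; translating back in the quotient restores this, and only then
  can uniqueness be applied. The same facts about translated path classes are needed for definable
  paths in \<open>G\<close> and for classical paths in the quotient. They are derived once, from
  axioms on the homotopy relation chosen so that no definable homotopy has to be reversed or glued.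
  Since \<open>compose\<close> and \<open>translate\<close> are unions over representatives, a
  membership criterion for such unions replaces the choice of representatives. The facts about the
  quotient have one source: the preimage of a type-definable set under a definable map is
  type-definable. For conjugations this yields, by minimality, that the infinitesimal subgroup is
  normal, so that the quotient is a group at all; for left multiplications it yields continuity in
  the logic topology.\<close>

section \<open>Translations of path groupoids\<close>

text \<open>The list records what translation uses of homotopy relative to endpoints, for definable
  and classical paths alike. It is kept free of symmetry and of compatibility with concatenation: a
  class is the set of functions reachable from \<open>a\<close>, and \<open>refl_right\<close> with
  \<open>trans\<close> makes that set closed. \<open>unit_interval_cong\<close> is there because
  paths are total functions: off the unit interval \<open>a\<close> may leave the carrier, where the
  group laws say nothing.\<close>

locale path_relation = group G for G (structure) +
  fixes E :: "('t::linordered_field \<Rightarrow> 'x) \<Rightarrow> ('t \<Rightarrow> 'x) \<Rightarrow> bool"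
  assumes in_carrier: "E a b \<Longrightarrow> t \<in> {0..1} \<Longrightarrow> a t \<in> carrier G"
    and ends: "E a b \<Longrightarrow> a 0 = b 0" "E a b \<Longrightarrow> a 1 = b 1"
    and refl_right: "E a b \<Longrightarrow> E b b"
    and trans: "E a b \<Longrightarrow> E b d \<Longrightarrow> E a d"
    and unit_interval_cong:
      "E a b \<Longrightarrow> (\<And>t. t \<in> {0..1} \<Longrightarrow> a t = a' t) \<Longrightarrow> (\<And>t. t \<in> {0..1} \<Longrightarrow> b t = b' t) \<Longrightarrow> E a' b'"
    and mult_left: "E a b \<Longrightarrow> x \<in> carrier G \<Longrightarrow> E (\<lambda>t. x \<otimes> a t) (\<lambda>t. x \<otimes> b t)"
begin

text \<open>These are the unions of path classes. The notion covers arrows as well as results of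
  \<open>compose\<close>, a union over pairs of representatives; so it never has to be shown that
  concatenation respects homotopy and yields a single class.\<close>

definition saturated_class :: "('t \<Rightarrow> 'x) set \<Rightarrow> bool" where
  "saturated_class c \<longleftrightarrow> (\<forall>a\<in>c. E a a \<and> (\<forall>b. E a b \<longrightarrow> b \<in> c))"

lemma saturated_UN_path_class: "saturated_class (\<Union>a\<in>A. path_class E a)"
  unfolding saturated_class_def path_class_def by (auto intro: refl_right elim: trans)

lemma saturated_path_class: "saturated_class (path_class E a)"
  using saturated_UN_path_class[of "{a}"] by simp

lemma mult_left_cancel:
  assumes "E (\<lambda>t. x \<otimes> a t) d" "x \<in> carrier G" "\<And>t. t \<in> {0..1} \<Longrightarrow> a t \<in> carrier G"
  shows "E a (\<lambda>t. inv x \<otimes> d t)"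
  by (rule unit_interval_cong[OF mult_left[OF assms(1), of "inv x"]])
    (use assms(2,3) in \<open>auto simp flip: m_assoc\<close>)

lemma mult_left_uncancel:
  assumes "E a (\<lambda>t. inv x \<otimes> d t)" "x \<in> carrier G" "\<And>t. t \<in> {0..1} \<Longrightarrow> d t \<in> carrier G"
  shows "E (\<lambda>t. x \<otimes> a t) d"
  by (rule unit_interval_cong[OF mult_left[OF assms(1,2)]])
    (use assms(2,3) in \<open>auto simp flip: m_assoc\<close>)

text \<open>On a union of classes, translating by \<open>x\<close> amounts to a preimage under
  multiplication by \<open>inv x\<close>, so the union over representatives in
  \<open>translate\<close> disappears. The condition on the values of \<open>d\<close> cannot be
  read off from the second conjunct: multiplication is a total function, and its value may lie in
  the carrier although \<open>d t\<close> does not.\<close>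

lemma mem_translate_iff:
  assumes c: "saturated_class c" and x: "x \<in> carrier G"
  shows "d \<in> translate G E x c \<longleftrightarrow>
    (\<forall>t\<in>{0..1}. d t \<in> carrier G) \<and> (\<lambda>t. inv x \<otimes> d t) \<in> c" (is "_ \<longleftrightarrow> ?R")
proof
  assume "d \<in> translate G E x c"
  then obtain a where a: "a \<in> c" "E (\<lambda>t. x \<otimes> a t) d"
    unfolding translate_def path_class_def by blast
  have "E a a" using a c unfolding saturated_class_def by blast
  then have "E a (\<lambda>t. inv x \<otimes> d t)" by (intro mult_left_cancel[OF a(2) x] in_carrier[of a a])
  moreover have "\<forall>t\<in>{0..1}. d t \<in> carrier G" using in_carrier[OF refl_right[OF a(2)]] by blast
  ultimately show ?R using a c unfolding saturated_class_def by blast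
next
  assume R: ?R
  then have "E (\<lambda>t. inv x \<otimes> d t) (\<lambda>t. inv x \<otimes> d t)" using c unfolding saturated_class_def by blast
  then have "E (\<lambda>t. x \<otimes> (inv x \<otimes> d t)) d" by (rule mult_left_uncancel[OF _ x]) (use R in blast)
  then show "d \<in> translate G E x c" using R unfolding translate_def path_class_def by blast
qed

text \<open>The membership criterion for one class shows that every representative gives the same
  translate. The assumption restricts only the values of \<open>a\<close> on the unit interval, so
  the constant functions in \<open>ident\<close> are covered without an axiom on constants.\<close>

lemma translate_path_class:
  assumes x: "x \<in> carrier G" and a: "\<And>t. t \<in> {0..1} \<Longrightarrow> a t \<in> carrier G"
  shows "translate G E x (path_class E a) = path_class E (\<lambda>t. x \<otimes> a t)"
proof -
  have "d \<in> translate G E x (path_class E a) \<longleftrightarrow> E (\<lambda>t. x \<otimes> a t) d" for d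
    unfolding mem_translate_iff[OF saturated_path_class x]
  proof
    assume "E (\<lambda>t. x \<otimes> a t) d"
    then show "(\<forall>t\<in>{0..1}. d t \<in> carrier G) \<and> (\<lambda>t. inv x \<otimes> d t) \<in> path_class E a"
      unfolding path_class_def mem_Collect_eq
      by (intro conjI ballI mult_left_cancel[OF _ x a] in_carrier[OF refl_right])
  next
    assume "(\<forall>t\<in>{0..1}. d t \<in> carrier G) \<and> (\<lambda>t. inv x \<otimes> d t) \<in> path_class E a"
    then show "E (\<lambda>t. x \<otimes> a t) d"
      using x unfolding path_class_def by (intro mult_left_uncancel) simp_all
  qed
  then show ?thesis unfolding path_class_def by blast
qed

lemma arrowE:
  assumes "c \<in> arrows (path_groupoid X E)"
  obtains a where "E a a" "c = path_class E a" "\<And>t. t \<in> {0..1} \<Longrightarrow> a t \<in> carrier G"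
  using assms in_carrier[of a a for a] unfolding path_groupoid_def by auto

lemma arrowI: "E a a \<Longrightarrow> path_class E a \<in> arrows (path_groupoid X E)"
  unfolding path_groupoid_def by auto

lemma source_path_class: "E a a \<Longrightarrow> source (path_groupoid X E) (path_class E a) = a 0"
  unfolding path_groupoid_def path_class_def groupoid.simps
  by (rule the_equality) (metis ends(1) mem_Collect_eq)+

lemma target_path_class: "E a a \<Longrightarrow> target (path_groupoid X E) (path_class E a) = a 1"
  unfolding path_groupoid_def path_class_def groupoid.simps
  by (rule the_equality) (metis ends(2) mem_Collect_eq)+

lemma
  assumes "c \<in> arrows (path_groupoid X E)" "x \<in> carrier G"
  shows translate_arrow: "translate G E x c \<in> arrows (path_groupoid X E)"
    and source_translate:
      "source (path_groupoid X E) (translate G E x c) = x \<otimes> source (path_groupoid X E) c"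
    and target_translate:
      "target (path_groupoid X E) (translate G E x c) = x \<otimes> target (path_groupoid X E) c"
    and translate_inv_translate: "translate G E x (translate G E (inv x) c) = c"
    and arrow_endpoints: "source (path_groupoid X E) c \<in> carrier G"
      "target (path_groupoid X E) c \<in> carrier G"
proof -
  obtain a where a: "E a a" "c = path_class E a" "\<And>t. t \<in> {0..1} \<Longrightarrow> a t \<in> carrier G"
    using assms(1) by (rule arrowE) blast
  note xa = mult_left[OF a(1) assms(2)]
  have t: "translate G E x c = path_class E (\<lambda>t. x \<otimes> a t)"
    using translate_path_class[OF assms(2) a(3)] a(2) by simp
  show "translate G E x c \<in> arrows (path_groupoid X E)" unfolding t by (rule arrowI[OF xa])
  show "source (path_groupoid X E) (translate G E x c) = x \<otimes> source (path_groupoid X E) c"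
    unfolding t source_path_class[OF xa] unfolding a(2) source_path_class[OF a(1)] ..
  show "target (path_groupoid X E) (translate G E x c) = x \<otimes> target (path_groupoid X E) c"
    unfolding t target_path_class[OF xa] unfolding a(2) target_path_class[OF a(1)] ..
  show "source (path_groupoid X E) c \<in> carrier G" "target (path_groupoid X E) c \<in> carrier G"
    unfolding a(2) source_path_class[OF a(1)] target_path_class[OF a(1)] using a(3) by auto
  \<comment> \<open>The two functions agree only on the unit interval, so it is their classes, not
    the functions, that are shown to be equal.\<close>
  have "E (\<lambda>t. x \<otimes> (inv x \<otimes> a t)) b \<longleftrightarrow> E a b" for b
    by (rule iffI; erule unit_interval_cong) (use a(3) assms(2) in \<open>auto simp flip: m_assoc\<close>)
  then have "path_class E (\<lambda>t. x \<otimes> (inv x \<otimes> a t)) = path_class E a"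
    unfolding path_class_def by blast
  then show "translate G E x (translate G E (inv x) c) = c"
    using translate_path_class[of "inv x" a] translate_path_class[of x "\<lambda>t. inv x \<otimes> a t"] assms(2) a(2,3)
    by simp
qed

lemma concat_mult_left:
  "(\<lambda>t. x \<otimes> concat_paths a b t) = concat_paths (\<lambda>t. x \<otimes> a t) (\<lambda>t. x \<otimes> b t)"
  by (auto simp: concat_paths_def)

text \<open>Left multiplication commutes with \<open>concat_paths\<close> on the nose. Both sides
  being unions over representatives, they are compared element by element: in one direction the
  representatives are multiplied by \<open>x\<close>, in the other by \<open>inv x\<close>.\<close>

lemma translate_compose:
  assumes f: "f \<in> arrows (path_groupoid X E)" and g: "g \<in> arrows (path_groupoid X E)"
    and x: "x \<in> carrier G"
  shows "translate G E x (compose (path_groupoid X E) f g) =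
    compose (path_groupoid X E) (translate G E x f) (translate G E x g)"
proof -
  have compose: "compose (path_groupoid X E) c d = (\<Union>a\<in>c. \<Union>b\<in>d. path_class E (concat_paths a b))"
    for c d by (simp add: path_groupoid_def)
  have sat: "saturated_class f" "saturated_class g"
    using f g saturated_path_class unfolding path_groupoid_def by auto
  have "saturated_class (compose (path_groupoid X E) f g)"
  proof -
    have "compose (path_groupoid X E) f g = (\<Union>e \<in> (\<lambda>(a, b). concat_paths a b) ` (f \<times> g). path_class E e)"
      unfolding compose by auto
    then show ?thesis by (simp only: saturated_UN_path_class)
  qed
  note mem = mem_translate_iff[OF this x] mem_translate_iff[OF sat(1) x] mem_translate_iff[OF sat(2) x]
  show ?thesis
  proof (intro equalityI subsetI)
    fix d assume d: "d \<in> translate G E x (compose (path_groupoid X E) f g)"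
    then obtain a b where ab: "a \<in> f" "b \<in> g" "E (concat_paths a b) (\<lambda>t. inv x \<otimes> d t)"
      unfolding mem unfolding compose path_class_def by blast
    have "E (concat_paths (\<lambda>t. x \<otimes> a t) (\<lambda>t. x \<otimes> b t)) d"
      using mult_left_uncancel[OF ab(3) x] d unfolding mem concat_mult_left by simp
    moreover have "(\<lambda>t. x \<otimes> e t) \<in> translate G E x c" if "saturated_class c" "e \<in> c" for c e
      using mult_left[of e e x] that x
      unfolding translate_def path_class_def saturated_class_def by blast
    then have "(\<lambda>t. x \<otimes> a t) \<in> translate G E x f" "(\<lambda>t. x \<otimes> b t) \<in> translate G E x g"
      using ab sat by simp_all
    ultimately show "d \<in> compose (path_groupoid X E) (translate G E x f) (translate G E x g)"
      unfolding compose path_class_def by blast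
  next
    fix d assume "d \<in> compose (path_groupoid X E) (translate G E x f) (translate G E x g)"
    then obtain a b where ab: "a \<in> translate G E x f" "b \<in> translate G E x g"
      "E (concat_paths a b) d" unfolding compose path_class_def by blast
    have "E (concat_paths (\<lambda>t. inv x \<otimes> a t) (\<lambda>t. inv x \<otimes> b t)) (\<lambda>t. inv x \<otimes> d t)"
      using mult_left[OF ab(3), of "inv x"] x unfolding concat_mult_left by simp
    moreover have "\<forall>t\<in>{0..1}. d t \<in> carrier G" using in_carrier[OF refl_right[OF ab(3)]] by blast
    ultimately show "d \<in> translate G E x (compose (path_groupoid X E) f g)"
      using ab(1,2) unfolding mem unfolding compose path_class_def by blast
  qed
qed

lemma translate_ident:
  "x \<in> carrier G \<Longrightarrow> p \<in> carrier G \<Longrightarrow>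
    translate G E x (ident (path_groupoid X E) p) = ident (path_groupoid X E) (x \<otimes> p)"
  by (simp add: path_groupoid_def translate_path_class)

end

text \<open>Translation by \<open>x\<close> moves the endpoints of an arrow by \<open>x\<close>; as
  \<open>q\<close> is a homomorphism, \<open>F\<close> turns this into a move by \<open>q x\<close>,
  which the outer translation takes back. Hence the composite lies over the same object map as
  \<open>F\<close>, and translations respect composition and identities on both sides.\<close>

lemma groupoid_morphism_conjugate:
  assumes AE: "path_relation A E" and BD: "path_relation B D"
    and F: "groupoid_morphism (path_groupoid (carrier A) E) (path_groupoid (carrier B) D) q F"
    and q: "q \<in> hom A B" and x: "x \<in> carrier A"
  shows "groupoid_morphism (path_groupoid (carrier A) E) (path_groupoid (carrier B) D) q
    (\<lambda>c. translate B D (inv\<^bsub>B\<^esub> (q x)) (F (translate A E x c)))"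
proof -
  interpret A: path_relation A E by fact
  interpret B: path_relation B D by fact
  let ?P = "path_groupoid (carrier A) E" and ?Q = "path_groupoid (carrier B) D"
  let ?y = "inv\<^bsub>B\<^esub> (q x)"
  have qx: "q x \<in> carrier B" and y: "?y \<in> carrier B" using q x by (auto simp: hom_def)
  have canc: "?y \<otimes>\<^bsub>B\<^esub> q (x \<otimes>\<^bsub>A\<^esub> p) = q p" if "p \<in> carrier A" for p
  proof -
    have "q p \<in> carrier B" using q that by (auto simp: hom_def)
    then show ?thesis using that x q qx by (simp add: hom_mult flip: B.m_assoc)
  qed
  have Fm: "F f \<in> arrows ?Q" "source ?Q (F f) = q (source ?P f)"
    "target ?Q (F f) = q (target ?P f)" if "f \<in> arrows ?P" for f
    using F that unfolding groupoid_morphism_def by auto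
  have Fi: "F (ident ?P p) = ident ?Q (q p)" if "p \<in> carrier A" for p
    using F that unfolding groupoid_morphism_def by (simp add: path_groupoid_def)
  have Fc: "F (compose ?P f g) = compose ?Q (F f) (F g)"
    if "f \<in> arrows ?P" "g \<in> arrows ?P" "target ?P f = source ?P g" for f g
    using F that unfolding groupoid_morphism_def by blast
  note tA = A.translate_arrow[OF _ x]
  show ?thesis unfolding groupoid_morphism_def
  proof (intro conjI ballI impI funcsetI)
    fix p assume "p \<in> objects ?P"
    then show "q p \<in> objects ?Q" using q by (auto simp: path_groupoid_def hom_def)
  next
    fix f assume "f \<in> arrows ?P"
    then show "translate B D ?y (F (translate A E x f)) \<in> arrows ?Q"
      by (intro B.translate_arrow Fm tA y)
  next
    fix f assume f: "f \<in> arrows ?P"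
    then show "source ?Q (translate B D ?y (F (translate A E x f))) = q (source ?P f)"
      by (simp add: B.source_translate[OF Fm(1) y] Fm tA A.source_translate x canc
          A.arrow_endpoints[OF f x])
    show "target ?Q (translate B D ?y (F (translate A E x f))) = q (target ?P f)"
      using f by (simp add: B.target_translate[OF Fm(1) y] Fm tA A.target_translate x canc
          A.arrow_endpoints[OF f x])
  next
    fix p assume "p \<in> objects ?P"
    then have p: "p \<in> carrier A" by (simp add: path_groupoid_def)
    have "q (x \<otimes>\<^bsub>A\<^esub> p) \<in> carrier B" using q x p by (simp add: hom_carrier hom_in_carrier)
    then show "translate B D ?y (F (translate A E x (ident ?P p))) = ident ?Q (q p)"
      using p x y by (simp add: A.translate_ident Fi B.translate_ident canc)
  next
    fix f g assume fg: "f \<in> arrows ?P" "g \<in> arrows ?P" "target ?P f = source ?P g"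
    have "translate A E x (compose ?P f g) = compose ?P (translate A E x f) (translate A E x g)"
      by (rule A.translate_compose[OF fg(1,2) x])
    moreover have "target ?P (translate A E x f) = source ?P (translate A E x g)"
      using fg x by (simp add: A.target_translate A.source_translate)
    ultimately show "translate B D ?y (F (translate A E x (compose ?P f g))) =
      compose ?Q (translate B D ?y (F (translate A E x f))) (translate B D ?y (F (translate A E x g)))"
      by (simp add: Fc[OF tA[OF fg(1)] tA[OF fg(2)]]
          B.translate_compose[OF Fm(1)[OF tA[OF fg(1)]] Fm(1)[OF tA[OF fg(2)]] y])
  qed
qed

section \<open>Definable sets and maps\<close>

lemma sat_foldr_Conj: "sat M zs (foldr Conj \<phi>s (Eq Zero Zero)) \<longleftrightarrow> (\<forall>\<phi>\<in>set \<phi>s. sat M zs \<phi>)"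
  by (induction \<phi>s) auto

lemma definable_UNIV: "definable M n (cart n)"
  unfolding definable_def by (rule exI[of _ "Eq Zero Zero"]) auto

lemma definable_singleton:
  assumes "x \<in> cart n" shows "definable M n {x}"
proof -
  \<comment> \<open>\<open>Var (n + i)\<close> reads the i-th parameter, the parameters being the
    coordinates of \<open>x\<close>.\<close>
  have "sat M (w @ x) (foldr Conj (map (\<lambda>i. Eq (Var i) (Var (n + i))) [0..<n]) (Eq Zero Zero)) \<longleftrightarrow> w = x"
    if "w \<in> cart n" for w
    using that assms by (auto simp: sat_foldr_Conj lookup_def cart_def nth_append intro: nth_equalityI)
  then show ?thesis using assms unfolding definable_def by blast
qed

lemma definable_Compl:
  assumes "definable M n X" shows "definable M n (cart n - X)"
proof -
  obtain p ps where "X = {w \<in> cart n. sat M (w @ ps) p}" using assms unfolding definable_def by blast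
  then have "cart n - X = {w \<in> cart n. sat M (w @ ps) (Neg p)}" by auto
  then show ?thesis unfolding definable_def by blast
qed

lemma definable_Int:
  assumes "definable M n X" "definable M n Y" shows "definable M n (X \<inter> Y)"
proof -
  have "X \<inter> Y = cart n - ((cart n - X) \<union> (cart n - Y))"
    using definable_cart assms by blast
  then show ?thesis using assms by (simp add: definable_Compl definable_Un)
qed

text \<open>Selecting, permuting or repeating coordinates is a substitution of variables. Together
  with projection it lets most graphs below be built from sets, without writing formulas.\<close>

lemma definable_reindex:
  assumes A: "definable M k A" and idx: "length idx = k" "set idx \<subseteq> {..<n}"
  shows "definable M n {w \<in> cart n. map ((!) w) idx \<in> A}"
proof -
  obtain p ps where p: "A = {w \<in> cart k. sat M (w @ ps) p}" using A unfolding definable_def by blast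
  \<comment> \<open>Position \<open>k + j\<close> of the old list holds the j-th parameter of
    \<open>p\<close>, and in the new list it is at \<open>n + j\<close>. Positions past the
    parameters stay past them, so both sides read the default 0 there.\<close>
  define s where "s i = (if i < k then idx ! i else n + (i - k))" for i
  have "sat M (w @ ps) (fren s p) \<longleftrightarrow> sat M (map ((!) w) idx @ ps) p" if "w \<in> cart n" for w
  proof (rule sat_fren)
    fix i
    have "idx ! i < n" if "i < k" using idx that nth_mem by fastforce
    then show "lookup (w @ ps) (s i) = lookup (map ((!) w) idx @ ps) i"
      using \<open>w \<in> cart n\<close> idx by (auto simp: lookup_def s_def nth_append cart_def)
  qed
  then have "{w \<in> cart n. map ((!) w) idx \<in> A} = {w \<in> cart n. sat M (w @ ps) (fren s p)}"
    using idx p by (auto simp: cart_def)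
  then show ?thesis unfolding definable_def by blast
qed

lemma definable_section:
  assumes A: "definable M (m + k) A" and x: "x \<in> cart k"
  shows "definable M m {w \<in> cart m. w @ x \<in> A}"
proof -
  obtain p ps where p: "A = {w \<in> cart (m + k). sat M (w @ ps) p}" using A unfolding definable_def by blast
  then have "{w \<in> cart m. w @ x \<in> A} = {w \<in> cart m. sat M (w @ (x @ ps)) p}"
    using x by (auto simp: cart_def)
  then show ?thesis unfolding definable_def by blast
qed

text \<open>\<open>Ex\<close> prepends its witness to the list of values, so it is the leading
  coordinates that can be quantified away, one at a time. For this reason later constructions put
  auxiliary values in front of the arguments.\<close>

lemma definable_projection:
  "definable M (n + m) A \<Longrightarrow> definable M m {w \<in> cart m. \<exists>u\<in>cart n. u @ w \<in> A}"
proof (induction n arbitrary: A)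
  case 0
  then have "{w \<in> cart m. \<exists>u\<in>cart 0. u @ w \<in> A} = A" using definable_cart[OF 0] by (auto simp: cart_def)
  then show ?case using 0 by simp
next
  case (Suc n)
  obtain p ps where p: "A = {w \<in> cart (Suc n + m). sat M (w @ ps) p}"
    using Suc.prems unfolding definable_def by blast
  have "{w \<in> cart (n + m). \<exists>x. x # w \<in> A} = {w \<in> cart (n + m). sat M (w @ ps) (Ex p)}"
    using p by (auto simp: cart_def)
  then have "definable M (n + m) {w \<in> cart (n + m). \<exists>x. x # w \<in> A}" unfolding definable_def by blast
  from Suc.IH[OF this]
  have "definable M m {w \<in> cart m. \<exists>u\<in>cart n. u @ w \<in> {w \<in> cart (n + m). \<exists>x. x # w \<in> A}}" .
  also have "{w \<in> cart m. \<exists>u\<in>cart n. u @ w \<in> {w \<in> cart (n + m). \<exists>x. x # w \<in> A}} =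
      {w \<in> cart m. \<exists>u\<in>cart (Suc n). u @ w \<in> A}"
  proof (intro Collect_cong conj_cong refl iffI)
    fix w assume "w \<in> cart m" "\<exists>u\<in>cart n. u @ w \<in> {w \<in> cart (n + m). \<exists>x. x # w \<in> A}"
    then obtain u x where "u \<in> cart n" "x # u @ w \<in> A" by blast
    then show "\<exists>u\<in>cart (Suc n). u @ w \<in> A"
      by (intro bexI[of _ "x # u"]) (auto simp: cart_def)
  next
    fix w assume w: "w \<in> cart m" and "\<exists>u\<in>cart (Suc n). u @ w \<in> A"
    then obtain u where u: "u \<in> cart (Suc n)" "u @ w \<in> A" by blast
    then obtain x v where "u = x # v" by (cases u) (auto simp: cart_def)
    then show "\<exists>u\<in>cart n. u @ w \<in> {w \<in> cart (n + m). \<exists>x. x # w \<in> A}"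
      using u w by (intro bexI[of _ v]) (auto simp: cart_def)
  qed
  finally show ?case .
qed

lemma map_nth_upt: "b \<le> length w \<Longrightarrow> map ((!) w) [a..<b] = take (b - a) (drop a w)"
  by (rule nth_equalityI) auto

lemma definable_cube: "definable M n (cube n)"
proof -
  have "cube n = {w \<in> cart n. sat M (w @ [])
    (foldr Conj (map (\<lambda>i. Conj (Neg (Less (Var i) Zero)) (Neg (Less One (Var i)))) [0..<n]) (Eq Zero Zero))}"
    by (auto simp: cube_def sat_foldr_Conj lookup_def cart_def not_less all_set_conv_all_nth)
  then show ?thesis unfolding definable_def by blast
qed

text \<open>Concatenated points are split by length: all points of \<open>X\<close> have length
  \<open>m\<close>, so a point of the graph determines its argument.\<close>

lemma mem_graph_iff:
  assumes "X \<subseteq> cart m" "length z = m"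
  shows "z @ u \<in> {z @ f z |z. z \<in> X} \<longleftrightarrow> z \<in> X \<and> u = f z"
proof
  assume "z @ u \<in> {z @ f z |z. z \<in> X}"
  then obtain z' where "z' \<in> X" "z @ u = z' @ f z'" by blast
  moreover from this have "length z' = length z" using assms by (auto simp: cart_def)
  ultimately show "z \<in> X \<and> u = f z" by simp
qed blast

section \<open>Definable maps, handled through their graphs\<close>

lemma definable_map_cong:
  assumes "definable_map M m n X Y f" "\<And>z. z \<in> X \<Longrightarrow> f z = g z"
  shows "definable_map M m n X Y g"
proof -
  have "{z @ f z |z. z \<in> X} = {z @ g z |z. z \<in> X}" 
    using assms(2) by (intro Collect_cong) metis
  then show ?thesis using assms unfolding definable_map_def by (auto simp: Pi_iff)
qed

lemma definable_map_const:
  assumes "definable M m X" "y \<in> Y" "Y \<subseteq> cart n"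
  shows "definable_map M m n X Y (\<lambda>_. y)"
proof -
  have X: "X \<subseteq> cart m" and y: "y \<in> cart n" using assms definable_cart[OF assms(1)] by auto
  have "definable M (m + n) ({w \<in> cart (m + n). map ((!) w) [0..<m] \<in> X} \<inter>
      {w \<in> cart (m + n). map ((!) w) [m..<m + n] \<in> {y}})"
    by (intro definable_Int definable_reindex[OF assms(1)] definable_reindex[OF definable_singleton[OF y]]) auto
  also have "\<dots> = {z @ y |z. z \<in> X}"
  proof (intro equalityI subsetI)
    fix w assume "w \<in> {w \<in> cart (m + n). map ((!) w) [0..<m] \<in> X} \<inter>
      {w \<in> cart (m + n). map ((!) w) [m..<m + n] \<in> {y}}"
    then have "take m w \<in> X" "drop m w = y" by (auto simp: cart_def map_nth_upt)
    then show "w \<in> {z @ y |z. z \<in> X}" by (auto intro!: exI[of _ "take m w"])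
  qed (use X y in \<open>auto simp: map_nth_upt cart_def\<close>)
  finally show ?thesis using assms X unfolding definable_map_def by auto
qed

lemma definable_map_id:
  assumes X: "definable M n X" shows "definable_map M n n X X (\<lambda>z. z)"
proof -
  have Xn: "X \<subseteq> cart n" by (rule definable_cart[OF X])
  let ?\<phi> = "foldr Conj (map (\<lambda>i. Eq (Var i) (Var (n + i))) [0..<n]) (Eq Zero Zero)"
  have "definable M (n + n) {w \<in> cart (n + n). sat M (w @ []) ?\<phi>}" unfolding definable_def by blast
  then have "definable M (n + n) ({w \<in> cart (n + n). map ((!) w) [0..<n] \<in> X} \<inter>
      {w \<in> cart (n + n). sat M (w @ []) ?\<phi>})"
    by (intro definable_Int definable_reindex[OF X]) auto
  also have "\<dots> = {z @ z |z. z \<in> X}"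
  proof (intro equalityI subsetI)
    fix w assume w: "w \<in> {w \<in> cart (n + n). map ((!) w) [0..<n] \<in> X} \<inter>
      {w \<in> cart (n + n). sat M (w @ []) ?\<phi>}"
    then have l: "length w = n + n" and sat: "sat M (w @ []) ?\<phi>" by (simp_all add: cart_def)
    have "w ! i = w ! (n + i)" if "i < n" for i
    proof -
      have "Eq (Var i) (Var (n + i)) \<in> set (map (\<lambda>i. Eq (Var i) (Var (n + i))) [0..<n])" using that by simp
      then have "sat M (w @ []) (Eq (Var i) (Var (n + i)))" using sat unfolding sat_foldr_Conj by blast
      then show ?thesis using that l by (simp add: lookup_def)
    qed
    then have "take n w = drop n w" using l by (intro nth_equalityI) simp_all
    then have "w = take n w @ take n w" by (metis append_take_drop_id)
    moreover have "take n w \<in> X" using w l by (simp add: map_nth_upt)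
    ultimately show "w \<in> {z @ z |z. z \<in> X}" by blast
  next
    fix w assume "w \<in> {z @ z |z. z \<in> X}"
    then obtain z where z: "z \<in> X" "w = z @ z" by blast
    then have "length z = n" using Xn by (auto simp: cart_def)
    then show "w \<in> {w \<in> cart (n + n). map ((!) w) [0..<n] \<in> X} \<inter>
        {w \<in> cart (n + n). sat M (w @ []) ?\<phi>}"
      using z by (simp add: cart_def map_nth_upt sat_foldr_Conj lookup_def nth_append)
  qed
  finally show ?thesis using Xn unfolding definable_map_def by auto
qed

text \<open>The value \<open>u = f z\<close> is placed in front of \<open>z\<close>, constrained by
  the graph and by \<open>D\<close>, and projected away.\<close>

lemma definable_map_preimage:
  assumes f: "definable_map M m n X Y f" and D: "definable M n D"
  shows "definable M m {z \<in> X. f z \<in> D}"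
proof -
  let ?B = "{w \<in> cart (n + m). map ((!) w) ([n..<n + m] @ [0..<n]) \<in> {z @ f z |z. z \<in> X}} \<inter>
      {w \<in> cart (n + m). map ((!) w) [0..<n] \<in> D}"
  have gr: "definable M (m + n) {z @ f z |z. z \<in> X}" and X: "X \<subseteq> cart m"
    and fc: "\<And>z. z \<in> X \<Longrightarrow> f z \<in> cart n" using f unfolding definable_map_def by auto
  have "definable M (n + m) ?B" by (intro definable_Int definable_reindex[OF gr] definable_reindex[OF D]) auto
  then have "definable M m {z \<in> cart m. \<exists>u\<in>cart n. u @ z \<in> ?B}" by (rule definable_projection)
  also have "{z \<in> cart m. \<exists>u\<in>cart n. u @ z \<in> ?B} = {z \<in> X. f z \<in> D}"
  proof -
    have "u @ z \<in> ?B \<longleftrightarrow> z \<in> X \<and> u = f z \<and> f z \<in> D" if "length u = n" "length z = m" for u z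
      using that mem_graph_iff[OF X, of z u f] by (simp add: map_nth_upt cart_def) blast
    then show ?thesis using X fc by (simp add: cart_def subset_iff) blast
  qed
  finally show ?thesis .
qed

text \<open>This is the homotopy that does not depend on its first parameter. It gives reflexivity,
  and it lets a path enter a pointwise product of homotopies.\<close>

lemma definable_map_snd_coordinate:
  assumes f: "definable_map M 1 n (cube 1) Y (\<lambda>z. a (z ! 0))"
  shows "definable_map M 2 n (cube 2) Y (\<lambda>z. a (z ! 1))"
proof -
  have gr: "definable M (1 + n) {z @ a (z ! 0) |z. z \<in> cube 1}"
    and fc: "\<And>z. z \<in> cube 1 \<Longrightarrow> a (z ! 0) \<in> Y" and Y: "Y \<subseteq> cart n"
    using f unfolding definable_map_def by auto
  have ac: "a t \<in> Y" if "0 \<le> t" "t \<le> 1" for t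
    using fc[of "[t]"] that by (auto simp: cube_def cart_def)
  have idx: "map ((!) w) [0..<2] = take 2 w" "map ((!) w) (1 # [2..<2 + n]) = w ! 1 # drop 2 w"
    if "length w = 2 + n" for w :: "'a list"
    using that unfolding list.map by (subst map_nth_upt; simp)+
  \<comment> \<open>The second index list skips position 0, the homotopy parameter, and so reads the
    graph of \<open>a\<close> at the second coordinate.\<close>
  have "definable M (2 + n) ({w \<in> cart (2 + n). map ((!) w) [0..<2] \<in> cube 2} \<inter>
      {w \<in> cart (2 + n). map ((!) w) (1 # [2..<2 + n]) \<in> {z @ a (z ! 0) |z. z \<in> cube 1}})"
    by (intro definable_Int definable_reindex[OF gr] definable_reindex[OF definable_cube]) auto
  also have "\<dots> = {w \<in> cart (2 + n). take 2 w \<in> cube 2 \<and>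
      w ! 1 # drop 2 w \<in> {z @ a (z ! 0) |z. z \<in> cube 1}}"
    by (auto simp only: Int_iff mem_Collect_eq cart_def idx)
  also have "\<dots> = {z @ a (z ! 1) |z. z \<in> cube 2}"
  proof (intro equalityI subsetI)
    fix w assume w: "w \<in> {w \<in> cart (2 + n). take 2 w \<in> cube 2 \<and>
      w ! 1 # drop 2 w \<in> {z @ a (z ! 0) |z. z \<in> cube 1}}"
    then obtain z where z: "z \<in> cube 1" "w ! 1 # drop 2 w = z @ a (z ! 0)" by blast
    then obtain t where "z = [t]" by (auto simp: cube_def cart_def length_Suc_conv)
    then have "drop 2 w = a (take 2 w ! 1)" using z by simp
    then have "w = take 2 w @ a (take 2 w ! 1)" by (metis append_take_drop_id)
    then show "w \<in> {z @ a (z ! 1) |z. z \<in> cube 2}" using w by blast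
  next
    fix w assume "w \<in> {z @ a (z ! 1) |z. z \<in> cube 2}"
    then obtain z where z: "w = z @ a (z ! 1)" "z \<in> cube 2" by blast
    then obtain s t where st: "z = [s, t]" by (auto simp: cube_def cart_def length_Suc_conv numeral_2_eq_2)
    then have t: "0 \<le> t" "t \<le> 1" using z by (auto simp: cube_def)
    then have "a t \<in> cart n" using ac Y by blast
    moreover have "[t] @ a ([t] ! 0) \<in> {z @ a (z ! 0) |z. z \<in> cube 1}"
      using t by (intro CollectI exI[of _ "[t]"]) (auto simp: cube_def cart_def)
    ultimately show "w \<in> {w \<in> cart (2 + n). take 2 w \<in> cube 2 \<and>
      w ! 1 # drop 2 w \<in> {z @ a (z ! 0) |z. z \<in> cube 1}}"
      using z st by (simp add: cart_def)
  qed
  finally have "definable M (2 + n) {z @ a (z ! 1) |z. z \<in> cube 2}" .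
  moreover have "a (z ! 1) \<in> Y" if "z \<in> cube 2" for z
    using that by (intro ac) (auto simp: cube_def cart_def)
  ultimately show ?thesis using Y unfolding definable_map_def by (auto simp: cube_def)
qed

section \<open>Pointwise products and inverses of definable maps into a definable group\<close>

context
  fixes M :: "('a::linordered_field, 'f, 'r) expansion" and n G
  assumes G: "definable_group M n G"
begin

private abbreviation (input) "\<mu> \<equiv> {x @ y @ (x \<otimes>\<^bsub>G\<^esub> y) | x y. x \<in> carrier G \<and> y \<in> carrier G}"

private lemma \<mu>: "definable M (3 * n) \<mu>"
  using G unfolding definable_group_def by auto

private lemma C: "carrier G \<subseteq> cart n"
  using G definable_cart unfolding definable_group_def by blast

private lemma \<mu>_iff:
  assumes "length u = n" "length v = n"
  shows "u @ v @ y \<in> \<mu> \<longleftrightarrow> u \<in> carrier G \<and> v \<in> carrier G \<and> y = u \<otimes>\<^bsub>G\<^esub> v"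
proof
  assume "u @ v @ y \<in> \<mu>"
  then obtain u' v' where uv: "u' \<in> carrier G" "v' \<in> carrier G" "u @ v @ y = u' @ v' @ (u' \<otimes>\<^bsub>G\<^esub> v')" by blast
  then have "length u' = length u" "length v' = length v" using assms C by (auto simp: cart_def)
  then show "u \<in> carrier G \<and> v \<in> carrier G \<and> y = u \<otimes>\<^bsub>G\<^esub> v" using uv by simp
qed blast

lemma definable_map_mult:
  assumes f: "definable_map M m n X (carrier G) f" and g: "definable_map M m n X (carrier G) g"
  shows "definable_map M m n X (carrier G) (\<lambda>z. f z \<otimes>\<^bsub>G\<^esub> g z)"
proof -
  interpret group G using G unfolding definable_group_def by blast
  have X: "X \<subseteq> cart m" and fg: "\<And>z. z \<in> X \<Longrightarrow> f z \<in> carrier G" "\<And>z. z \<in> X \<Longrightarrow> g z \<in> carrier G"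
    and gr: "definable M (m + n) {z @ f z |z. z \<in> X}" "definable M (m + n) {z @ g z |z. z \<in> X}"
    using f g unfolding definable_map_def by auto
  let ?N = "(n + n) + (m + n)"
  \<comment> \<open>The coordinates are \<open>u\<close>, \<open>v\<close>, \<open>z\<close>,
    \<open>y\<close>: the two factors to be projected away come first, then the argument and the
    product. Each index list gathers the coordinates of one graph.\<close>
  define B where "B = {w \<in> cart ?N. map ((!) w) ([n + n..<n + n + m] @ [0..<n]) \<in> {z @ f z |z. z \<in> X}} \<inter>
     ({w \<in> cart ?N. map ((!) w) ([n + n..<n + n + m] @ [n..<n + n]) \<in> {z @ g z |z. z \<in> X}} \<inter>
      {w \<in> cart ?N. map ((!) w) ([0..<n + n] @ [n + n + m..<?N]) \<in> \<mu>})"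
  have B: "definable M ?N B" unfolding B_def
    by (intro definable_Int definable_reindex[OF gr(1)] definable_reindex[OF gr(2)] definable_reindex[OF \<mu>]) auto
  note gr_iff = mem_graph_iff[OF X]
  have B_iff: "(u @ v) @ (z @ y) \<in> B \<longleftrightarrow> z \<in> X \<and> u = f z \<and> v = g z \<and> y = f z \<otimes>\<^bsub>G\<^esub> g z"
    if "length u = n" "length v = n" "length z = m" "length y = n" for u v z y
  proof -
    let ?w = "(u @ v) @ (z @ y)"
    have "map ((!) ?w) ([n + n..<n + n + m] @ [0..<n]) = z @ u"
      "map ((!) ?w) ([n + n..<n + n + m] @ [n..<n + n]) = z @ v"
      "map ((!) ?w) ([0..<n + n] @ [n + n + m..<?N]) = u @ v @ y"
      using that by (simp_all add: map_nth_upt)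
    then have "?w \<in> B \<longleftrightarrow> z @ u \<in> {z @ f z |z. z \<in> X} \<and> z @ v \<in> {z @ g z |z. z \<in> X} \<and> u @ v @ y \<in> \<mu>"
      unfolding B_def cart_def Int_iff mem_Collect_eq[of _ "\<lambda>w. w \<in> _ \<and> _ w"] mem_Collect_eq[of _ "\<lambda>w. length w = _"]
      using that by simp
    then show ?thesis using fg gr_iff[OF that(3)] \<mu>_iff[OF that(1,2)] by auto
  qed
  have "{z @ (f z \<otimes>\<^bsub>G\<^esub> g z) |z. z \<in> X} = {w \<in> cart (m + n). \<exists>u\<in>cart (n + n). u @ w \<in> B}"
  proof (intro equalityI subsetI)
    fix w assume "w \<in> {z @ (f z \<otimes>\<^bsub>G\<^esub> g z) |z. z \<in> X}"
    then obtain z where z: "z \<in> X" "w = z @ (f z \<otimes>\<^bsub>G\<^esub> g z)" by blast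
    have l: "length (f z) = n" "length (g z) = n" "length z = m" "length (f z \<otimes>\<^bsub>G\<^esub> g z) = n"
      using z(1) fg C X m_closed by (auto simp: cart_def subset_iff)
    then show "w \<in> {w \<in> cart (m + n). \<exists>u\<in>cart (n + n). u @ w \<in> B}"
      using z B_iff[OF l(1,2,3,4)] by (auto simp: cart_def intro!: exI[of _ "f z @ g z"])
  next
    fix w assume "w \<in> {w \<in> cart (m + n). \<exists>u\<in>cart (n + n). u @ w \<in> B}"
    then obtain u where u: "u \<in> cart (n + n)" "u @ w \<in> B" and w: "w \<in> cart (m + n)" by blast
    have "(take n u @ drop n u) @ (take m w @ drop m w) \<in> B" using u by simp
    then have "take m w \<in> X" "drop m w = f (take m w) \<otimes>\<^bsub>G\<^esub> g (take m w)"
      using u w by (subst (asm) B_iff; simp add: cart_def)+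
    then show "w \<in> {z @ (f z \<otimes>\<^bsub>G\<^esub> g z) |z. z \<in> X}" by (metis (mono_tags, lifting) append_take_drop_id mem_Collect_eq)
  qed
  then have "definable M (m + n) {z @ (f z \<otimes>\<^bsub>G\<^esub> g z) |z. z \<in> X}"
    using definable_projection[OF B] by simp
  then show ?thesis using X C fg unfolding definable_map_def by auto
qed

text \<open>Only multiplication is definable by assumption. The graph of inversion is the fibre of
  the multiplication graph over the neutral element, because a product equal to it determines the
  second factor; a projection then composes inversion with \<open>f\<close>.\<close>

lemma definable_map_inv:
  assumes f: "definable_map M m n X (carrier G) f"
  shows "definable_map M m n X (carrier G) (\<lambda>z. inv\<^bsub>G\<^esub> f z)"
proof -
  interpret group G using G unfolding definable_group_def by blast
  have X: "X \<subseteq> cart m" and fc: "\<And>z. z \<in> X \<Longrightarrow> f z \<in> carrier G"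
    and gr: "definable M (m + n) {z @ f z |z. z \<in> X}"
    using f unfolding definable_map_def by auto
  define \<nu> where "\<nu> = {w \<in> cart (n + n). w @ \<one>\<^bsub>G\<^esub> \<in> \<mu>}"
  have \<nu>: "definable M (n + n) \<nu>" unfolding \<nu>_def
    by (rule definable_section[of M "n + n" n]) (use \<mu> C in \<open>auto simp: algebra_simps mult_2 eval_nat_numeral\<close>)
  have "length \<one>\<^bsub>G\<^esub> = n" using C one_closed by (auto simp: cart_def)
  then have \<nu>_iff: "u @ y \<in> \<nu> \<longleftrightarrow> u \<in> carrier G \<and> y = inv\<^bsub>G\<^esub> u"
    if "length u = n" "length y = n" for u y
  proof -
    have "u @ y \<in> \<nu> \<longleftrightarrow> u @ y @ \<one>\<^bsub>G\<^esub> \<in> \<mu>" using that by (simp add: \<nu>_def cart_def)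
    also have "\<dots> \<longleftrightarrow> u \<in> carrier G \<and> y \<in> carrier G \<and> \<one>\<^bsub>G\<^esub> = u \<otimes>\<^bsub>G\<^esub> y" by (rule \<mu>_iff[OF that])
    also have "\<dots> \<longleftrightarrow> u \<in> carrier G \<and> y = inv\<^bsub>G\<^esub> u"
      by (metis inv_closed inv_equality inv_comm r_inv)
    finally show ?thesis .
  qed
  let ?N = "n + (m + n)"
  define B where "B = {w \<in> cart ?N. map ((!) w) ([n..<n + m] @ [0..<n]) \<in> {z @ f z |z. z \<in> X}} \<inter>
      {w \<in> cart ?N. map ((!) w) ([0..<n] @ [n + m..<?N]) \<in> \<nu>}"
  have B: "definable M ?N B" unfolding B_def
    by (intro definable_Int definable_reindex[OF gr] definable_reindex[OF \<nu>]) auto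
  note gr_iff = mem_graph_iff[OF X]
  have B_iff: "u @ (z @ y) \<in> B \<longleftrightarrow> z \<in> X \<and> u = f z \<and> y = inv\<^bsub>G\<^esub> f z"
    if "length u = n" "length z = m" "length y = n" for u z y
  proof -
    let ?w = "u @ (z @ y)"
    have "map ((!) ?w) ([n..<n + m] @ [0..<n]) = z @ u" "map ((!) ?w) ([0..<n] @ [n + m..<?N]) = u @ y"
      using that by (simp_all add: map_nth_upt)
    then have "?w \<in> B \<longleftrightarrow> z @ u \<in> {z @ f z |z. z \<in> X} \<and> u @ y \<in> \<nu>"
      unfolding B_def cart_def Int_iff mem_Collect_eq[of _ "\<lambda>w. w \<in> _ \<and> _ w"] mem_Collect_eq[of _ "\<lambda>w. length w = _"]
      using that by simp
    then show ?thesis using fc gr_iff[OF that(2)] \<nu>_iff[OF that(1,3)] by auto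
  qed
  have "{z @ inv\<^bsub>G\<^esub> f z |z. z \<in> X} = {w \<in> cart (m + n). \<exists>u\<in>cart n. u @ w \<in> B}"
  proof (intro equalityI subsetI)
    fix w assume "w \<in> {z @ inv\<^bsub>G\<^esub> f z |z. z \<in> X}"
    then obtain z where z: "z \<in> X" "w = z @ inv\<^bsub>G\<^esub> f z" by blast
    have l: "length (f z) = n" "length z = m" "length (inv\<^bsub>G\<^esub> f z) = n"
      using z(1) fc C X inv_closed by (auto simp: cart_def subset_iff)
    then show "w \<in> {w \<in> cart (m + n). \<exists>u\<in>cart n. u @ w \<in> B}"
      using z B_iff[OF l] by (auto simp: cart_def intro!: exI[of _ "f z"])
  next
    fix w assume "w \<in> {w \<in> cart (m + n). \<exists>u\<in>cart n. u @ w \<in> B}"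
    then obtain u where u: "u \<in> cart n" "u @ w \<in> B" and w: "w \<in> cart (m + n)" by blast
    have "u @ (take m w @ drop m w) \<in> B" using u by simp
    then have "take m w \<in> X" "drop m w = inv\<^bsub>G\<^esub> f (take m w)"
      using u w by (subst (asm) B_iff; simp add: cart_def)+
    then show "w \<in> {z @ inv\<^bsub>G\<^esub> f z |z. z \<in> X}" by (metis (mono_tags, lifting) append_take_drop_id mem_Collect_eq)
  qed
  then have "definable M (m + n) {z @ inv\<^bsub>G\<^esub> f z |z. z \<in> X}"
    using definable_projection[OF B] by simp
  then show ?thesis using X C fc unfolding definable_map_def by auto
qed

end

section \<open>Conjugate subgroups\<close>

text \<open>The conjugate \<open>inv g H g\<close> is the competitor to which minimality of
  \<open>H\<close> will be applied. Its coset of \<open>y\<close> is the left translate by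
  \<open>inv g\<close> of the coset \<open>H (g y)\<close>, so it has no more cosets than
  \<open>H\<close>, which keeps the index bounded.\<close>

lemma (in group)
  assumes H: "subgroup H G" and g: "g \<in> carrier G"
  shows subgroup_conjugate: "subgroup {h \<in> carrier G. g \<otimes> h \<otimes> inv g \<in> H} G" (is "subgroup ?K G")
    and rcosets_conjugate:
      "rcosets {h \<in> carrier G. g \<otimes> h \<otimes> inv g \<in> H} \<subseteq> (\<lambda>C. inv g <# C) ` (rcosets H)"
proof -
  interpret H: subgroup H G by fact
  have cancel: "inv g \<otimes> (g \<otimes> z) = z" "g \<otimes> (inv g \<otimes> z) = z" if "z \<in> carrier G" for z
    using that g by (simp_all flip: m_assoc)
  show "subgroup ?K G"
  proof
    fix x y assume xy: "x \<in> ?K" "y \<in> ?K"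
    have e: "(g \<otimes> x \<otimes> inv g) \<otimes> (g \<otimes> y \<otimes> inv g) = g \<otimes> (x \<otimes> y) \<otimes> inv g"
      using xy g by (simp add: m_assoc cancel)
    have "(g \<otimes> x \<otimes> inv g) \<otimes> (g \<otimes> y \<otimes> inv g) \<in> H"
      using xy by (intro subgroup.m_closed[OF H, of "g \<otimes> x \<otimes> inv g" "g \<otimes> y \<otimes> inv g"]) simp_all
    then show "x \<otimes> y \<in> ?K" using xy unfolding e by simp
  next
    fix x assume x: "x \<in> ?K"
    have e: "inv (g \<otimes> x \<otimes> inv g) = g \<otimes> inv x \<otimes> inv g"
      using x g by (simp add: inv_mult_group m_assoc)
    have "inv (g \<otimes> x \<otimes> inv g) \<in> H" using x by (intro H.m_inv_closed) simp
    then show "inv x \<in> ?K" using x unfolding e by simp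
  qed (use g in auto)
  show "rcosets ?K \<subseteq> (\<lambda>C. inv g <# C) ` (rcosets H)"
  proof
    fix C assume "C \<in> rcosets ?K"
    then obtain y where y: "y \<in> carrier G" "C = ?K #> y" unfolding RCOSETS_def by blast
    have "C = inv g <# (H #> (g \<otimes> y))" unfolding y(2)
    proof (intro equalityI subsetI)
      fix u assume "u \<in> ?K #> y"
      then obtain h where h: "h \<in> ?K" "u = h \<otimes> y" unfolding r_coset_def by blast
      then have "u = inv g \<otimes> ((g \<otimes> h \<otimes> inv g) \<otimes> (g \<otimes> y))"
        using g y(1) by (simp add: m_assoc cancel)
      then show "u \<in> inv g <# (H #> (g \<otimes> y))" using h(1)
        unfolding l_coset_def r_coset_def by fast
    next
      fix u assume "u \<in> inv g <# (H #> (g \<otimes> y))"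
      then obtain h where h: "h \<in> H" "u = inv g \<otimes> (h \<otimes> (g \<otimes> y))"
        unfolding l_coset_def r_coset_def by blast
      have hG: "h \<in> carrier G" using h(1) by (rule H.mem_carrier)
      have "g \<otimes> (inv g \<otimes> h \<otimes> g) \<otimes> inv g = h" using g hG by (simp add: m_assoc cancel)
      then have "inv g \<otimes> h \<otimes> g \<in> ?K" using h(1) hG g by simp
      moreover have "u = (inv g \<otimes> h \<otimes> g) \<otimes> y"
        using g y(1) hG unfolding h(2) by (simp add: m_assoc)
      ultimately show "u \<in> ?K #> y" unfolding r_coset_def UN_iff singleton_iff by (rule rev_bexI)
    qed
    moreover have "H #> (g \<otimes> y) \<in> rcosets H" using g y(1) by (intro rcosetsI H.subset m_closed)
    ultimately show "C \<in> (\<lambda>C. inv g <# C) ` (rcosets H)" by (rule image_eqI)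
  qed
qed

section \<open>Definable homotopy\<close>

lemma continuous_map_snd_coordinate:
  assumes "continuous_map (subtopology (box_topology 1) (cube 1)) T (\<lambda>z. a (z ! 0))"
  shows "continuous_map (subtopology (box_topology 2) (cube 2)) T (\<lambda>z. a (z ! 1))"
proof -
  have top: "topspace (box_topology m) = cart m" for m :: nat
    unfolding topspace_def openin_box_topology by (auto intro!: exI[of _ "cart m"] zero_less_one)
  have "continuous_map (box_topology 2) (box_topology 1) (\<lambda>z :: 'a list. [z ! 1])"
    unfolding continuous_map_def top
  proof (intro conjI funcsetI allI impI)
    fix U :: "'a list set" assume U: "openin (box_topology 1) U"
    show "openin (box_topology 2) {z \<in> cart 2. [z ! 1] \<in> U}"
      unfolding openin_box_topology
    proof (intro conjI ballI)
      fix z assume "z \<in> {z \<in> cart 2. [z ! 1] \<in> U}"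
      then obtain e where e: "e > 0" "\<forall>y\<in>cart 1. (\<forall>i<1. \<bar>y ! i - [z ! 1] ! i\<bar> < e) \<longrightarrow> y \<in> U"
        using U unfolding openin_box_topology by blast
      show "\<exists>e>0. \<forall>y\<in>cart 2. (\<forall>i<2. \<bar>y ! i - z ! i\<bar> < e) \<longrightarrow> y \<in> {z \<in> cart 2. [z ! 1] \<in> U}"
      \<comment> \<open>Dropping a coordinate does not increase the box distance, so the same radius
        serves.\<close>
      proof (intro exI[of _ e] conjI e(1) ballI impI CollectI)
        fix y assume "y \<in> cart 2" "\<forall>i<2. \<bar>y ! i - z ! i\<bar> < e"
        then show "[y ! 1] \<in> U" using e(2) by (auto simp: cart_def)
      qed
    qed auto
  qed (auto simp: cart_def)
  then have "continuous_map (subtopology (box_topology 2) (cube 2))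
      (subtopology (box_topology 1) (cube 1)) (\<lambda>z :: 'a list. [z ! 1])"
    by (intro continuous_map_into_subtopology continuous_map_from_subtopology)
      (auto simp: cube_def cart_def)
  from continuous_map_compose[OF this assms] show ?thesis by (simp add: o_def)
qed

lemma definable_path_cong:
  assumes "definable_path M n T a" "\<And>t. t \<in> {0..1} \<Longrightarrow> a t = b t"
  shows "definable_path M n T b"
proof -
  have ab: "a (z ! 0) = b (z ! 0)" if "z \<in> cube 1" for z
    using that by (intro assms(2)) (auto simp: cube_def cart_def)
  show ?thesis using assms(1) ab unfolding definable_path_def
    by (auto elim!: definable_map_cong continuous_map_eq)
qed

lemma definable_path_in_topspace:
  assumes "definable_path M n T a" "t \<in> {0..1}" shows "a t \<in> topspace T"
proof -
  have "[t] \<in> cube 1" using assms(2) by (auto simp: cube_def cart_def)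
  then have "a ([t] ! 0) \<in> topspace T"
    using assms(1) unfolding definable_path_def definable_map_def by blast
  then show ?thesis by simp
qed

lemma definably_homotopic_cong:
  assumes "definably_homotopic M n T a b"
    and ab: "\<And>t. t \<in> {0..1} \<Longrightarrow> a t = a' t" "\<And>t. t \<in> {0..1} \<Longrightarrow> b t = b' t"
  shows "definably_homotopic M n T a' b'"
proof -
  have "definable_path M n T a'" "definable_path M n T b'"
    using assms definable_path_cong unfolding definably_homotopic_def by blast+
  moreover have "a 0 = a' 0" "a 1 = a' 1" by (auto intro: ab)
  ultimately show ?thesis using assms unfolding definably_homotopic_def by auto
qed

lemma definably_homotopic_refl:
  assumes "definable_path M n T a" shows "definably_homotopic M n T a a"
  using assms definable_map_snd_coordinate continuous_map_snd_coordinate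
  unfolding definably_homotopic_def definable_path_def
  by (intro conjI exI[of _ "\<lambda>s. a"]) auto

text \<open>The definition ties the sides of the homotopy square to the endpoints of
  \<open>a\<close> only; the corners at \<open>s = 1\<close> lie on the edge \<open>b\<close> as
  well.\<close>

lemma definably_homotopic_ends:
  fixes M :: "('a::linordered_field, 'f, 'r) expansion"
  assumes "definably_homotopic M n T a b" shows "a 0 = b 0" "a 1 = b 1"
proof -
  obtain h :: "'a \<Rightarrow> 'a \<Rightarrow> 'a list" where "\<forall>t\<in>{0..1}. h 0 t = a t \<and> h 1 t = b t" "\<forall>s\<in>{0..1}. h s 0 = a 0 \<and> h s 1 = a 1"
    using assms unfolding definably_homotopic_def by blast
  then show "a 0 = b 0" "a 1 = b 1" by (metis atLeastAtMost_iff order_refl zero_le_one)+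
qed

section \<open>Definable homotopy of paths in a definable group\<close>

context
  fixes M :: "('a::linordered_field, 'f, 'r) expansion" and n G T
  assumes G: "definable_group M n G" and T: "group_manifold_topology M n G T"
begin

lemma topspace_carrier: "topspace T = carrier G"
  using T unfolding group_manifold_topology_def by blast

lemma continuous_map_group_mult:
  assumes "continuous_map X T f" "continuous_map X T g"
  shows "continuous_map X T (\<lambda>z. f z \<otimes>\<^bsub>G\<^esub> g z)"
  using continuous_map_compose[OF continuous_map_pairedI[OF assms], of T "\<lambda>(x, y). x \<otimes>\<^bsub>G\<^esub> y"] T
  unfolding group_manifold_topology_def by (simp add: o_def)

lemma continuous_map_group_inv:
  assumes "continuous_map X T f"
  shows "continuous_map X T (\<lambda>z. inv\<^bsub>G\<^esub> f z)"
  using continuous_map_compose[OF assms, of T "\<lambda>x. inv\<^bsub>G\<^esub> x"] T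
  unfolding group_manifold_topology_def by (simp add: o_def)

lemma definable_map_mult_left:
  assumes "definable_map M m n X (carrier G) f" "definable M m X" "x \<in> carrier G"
  shows "definable_map M m n X (carrier G) (\<lambda>z. x \<otimes>\<^bsub>G\<^esub> f z)"
  using assms definable_map_mult[OF G definable_map_const[OF assms(2,3)] assms(1)]
    definable_cart[of M n "carrier G"] G unfolding definable_group_def by blast

lemma definable_path_mult_left:
  assumes "definable_path M n T a" "x \<in> carrier G"
  shows "definable_path M n T (\<lambda>t. x \<otimes>\<^bsub>G\<^esub> a t)"
  using assms unfolding definable_path_def topspace_carrier
  by (auto intro!: definable_map_mult_left definable_cube continuous_map_group_mult
      simp: topspace_carrier)

lemma definably_homotopic_mult_left:
  assumes "definably_homotopic M n T a b" "x \<in> carrier G"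
  shows "definably_homotopic M n T (\<lambda>t. x \<otimes>\<^bsub>G\<^esub> a t) (\<lambda>t. x \<otimes>\<^bsub>G\<^esub> b t)"
proof -
  obtain h where h: "definable_map M 2 n (cube 2) (topspace T) (\<lambda>z. h (z ! 0) (z ! 1))"
      "continuous_map (subtopology (box_topology 2) (cube 2)) T (\<lambda>z. h (z ! 0) (z ! 1))"
      "\<forall>t\<in>{0..1}. h 0 t = a t \<and> h 1 t = b t" "\<forall>s\<in>{0..1}. h s 0 = a 0 \<and> h s 1 = a 1"
    using assms unfolding definably_homotopic_def by blast
  have "definable_path M n T (\<lambda>t. x \<otimes>\<^bsub>G\<^esub> a t)" "definable_path M n T (\<lambda>t. x \<otimes>\<^bsub>G\<^esub> b t)"
    using assms definable_path_mult_left unfolding definably_homotopic_def by blast+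
  moreover have "definable_map M 2 n (cube 2) (topspace T) (\<lambda>z. x \<otimes>\<^bsub>G\<^esub> h (z ! 0) (z ! 1))"
    using h(1) assms(2) definable_cube definable_map_mult_left unfolding topspace_carrier by blast
  moreover have "continuous_map (subtopology (box_topology 2) (cube 2)) T
      (\<lambda>z. x \<otimes>\<^bsub>G\<^esub> h (z ! 0) (z ! 1))"
    using h(2) assms(2) by (intro continuous_map_group_mult) (simp_all add: topspace_carrier)
  ultimately show ?thesis using h(3,4) unfolding definably_homotopic_def
    by (intro conjI exI[of _ "\<lambda>s t. x \<otimes>\<^bsub>G\<^esub> h s t"]) simp_all
qed

text \<open>
  In a group, homotopies \<open>h\<close> from \<open>a\<close> to \<open>b\<close> and \<open>k\<close> from \<open>b\<close> to \<open>d\<close> need not be glued: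
  the pointwise product \<open>h b\<^sup>-\<^sup>1 k\<close> is a homotopy from \<open>a\<close> to \<open>d\<close>.
\<close>

lemma definably_homotopic_trans:
  assumes "definably_homotopic M n T a b" "definably_homotopic M n T b d"
  shows "definably_homotopic M n T a d"
proof -
  interpret group G using G unfolding definable_group_def by blast
  obtain h where h: "definable_map M 2 n (cube 2) (topspace T) (\<lambda>z. h (z ! 0) (z ! 1))"
      "continuous_map (subtopology (box_topology 2) (cube 2)) T (\<lambda>z. h (z ! 0) (z ! 1))"
      "\<forall>t\<in>{0..1}. h 0 t = a t \<and> h 1 t = b t" "\<forall>s\<in>{0..1}. h s 0 = a 0 \<and> h s 1 = a 1"
    using assms(1) unfolding definably_homotopic_def by blast
  obtain k where k: "definable_map M 2 n (cube 2) (topspace T) (\<lambda>z. k (z ! 0) (z ! 1))"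
      "continuous_map (subtopology (box_topology 2) (cube 2)) T (\<lambda>z. k (z ! 0) (z ! 1))"
      "\<forall>t\<in>{0..1}. k 0 t = b t \<and> k 1 t = d t" "\<forall>s\<in>{0..1}. k s 0 = b 0 \<and> k s 1 = b 1"
    using assms(2) unfolding definably_homotopic_def by blast
  have paths: "definable_path M n T a" "definable_path M n T b" "definable_path M n T d"
    using assms unfolding definably_homotopic_def by auto
  then have b: "definable_map M 2 n (cube 2) (topspace T) (\<lambda>z. b (z ! 1))"
      "continuous_map (subtopology (box_topology 2) (cube 2)) T (\<lambda>z. b (z ! 1))"
    using definable_map_snd_coordinate continuous_map_snd_coordinate unfolding definable_path_def
    by blast+
  define g where "g s t = h s t \<otimes>\<^bsub>G\<^esub> (inv\<^bsub>G\<^esub> b t \<otimes>\<^bsub>G\<^esub> k s t)" for s t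
  have "definable_map M 2 n (cube 2) (topspace T) (\<lambda>z. g (z ! 0) (z ! 1))"
    using h(1) k(1) b(1) unfolding g_def topspace_carrier
    by (intro definable_map_mult[OF G] definable_map_inv[OF G])
  moreover have "continuous_map (subtopology (box_topology 2) (cube 2)) T (\<lambda>z. g (z ! 0) (z ! 1))"
    unfolding g_def by (intro continuous_map_group_mult continuous_map_group_inv h k b)
  moreover have car: "a t \<in> carrier G" "b t \<in> carrier G" "d t \<in> carrier G" if "t \<in> {0..1}" for t
    using that paths definable_path_in_topspace unfolding topspace_carrier[symmetric] by blast+
  \<comment> \<open>At \<open>s = 0\<close> the factor \<open>k s t\<close> is \<open>b t\<close>
    and cancels against the inverse, at \<open>s = 1\<close> the factor \<open>h s t\<close> does.
    On the sides of the square \<open>k\<close> stays at an endpoint of \<open>b\<close>, so only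
    \<open>h\<close> survives.\<close>
  have "\<forall>t\<in>{0..1}. g 0 t = a t \<and> g 1 t = d t"
    using h(3) k(3) car by (simp add: g_def) (simp flip: m_assoc)
  moreover have "\<forall>s\<in>{0..1}. g s 0 = a 0 \<and> g s 1 = a 1"
    using h(4) k(4) car[of 0] car[of 1] by (simp add: g_def)
  ultimately show ?thesis using paths unfolding definably_homotopic_def by blast
qed

lemma path_relation_definably_homotopic: "path_relation G (definably_homotopic M n T)"
proof -
  interpret group G using G unfolding definable_group_def by blast
  show ?thesis
  proof
    show "a t \<in> carrier G" if "definably_homotopic M n T a b" "t \<in> {0..1}" for a b t
      using that definable_path_in_topspace unfolding definably_homotopic_def topspace_carrier[symmetric]
      by blast
    show "definably_homotopic M n T b b" if "definably_homotopic M n T a b" for a b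
      using that definably_homotopic_refl unfolding definably_homotopic_def by blast
  qed (fact definably_homotopic_ends definably_homotopic_trans definably_homotopic_cong
      definably_homotopic_mult_left)+
qed

end

text \<open>Classical homotopies are glued by \<open>homotopic_with_trans\<close>, so continuity of
  each single left translation suffices here, whereas the definable side multiplies homotopies
  pointwise and draws on joint continuity.\<close>

lemma path_relation_path_homotopic:
  fixes Q :: "'b monoid" and X :: "'b topology"
  assumes "group Q" "topspace X = carrier Q"
    and cont: "\<And>y. y \<in> carrier Q \<Longrightarrow> continuous_map X X (\<lambda>c. y \<otimes>\<^bsub>Q\<^esub> c)"
  shows "path_relation Q (path_homotopic X)"
proof -
  interpret group Q by fact
  show ?thesis
  proof
    fix a b :: "real \<Rightarrow> 'b" assume ab: "path_homotopic X a b"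
    have ends: "b 0 = a 0" "b 1 = a 1"
      and maps: "continuous_map (top_of_set {0..1}) X a" "continuous_map (top_of_set {0..1}) X b"
      using homotopic_with_imp_property[OF ab[unfolded path_homotopic_def]]
        homotopic_with_imp_continuous_maps[OF ab[unfolded path_homotopic_def]] by auto
    show "a t \<in> carrier Q" if "t \<in> {0..1}" for t
      using that continuous_map_funspace[OF maps(1)] assms(2) by auto
    show "a 0 = b 0" "a 1 = b 1" by (simp_all add: ends)
    show "path_homotopic X b b" using maps by (simp add: path_homotopic_def)
    show "path_homotopic X a d" if "path_homotopic X b d" for d
      using ab that unfolding path_homotopic_def ends by (rule homotopic_with_trans)
    show "path_homotopic X a' b'"
      if eq: "\<And>t. t \<in> {0..1} \<Longrightarrow> a t = a' t" "\<And>t. t \<in> {0..1} \<Longrightarrow> b t = b' t" for a' b'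
    proof -
      have e: "a' 0 = a 0" "a' 1 = a 1" "b' 0 = a 0" "b' 1 = a 1"
        using eq[of 0] eq[of 1] ends by simp_all
      let ?H = "homotopic_with (\<lambda>r. r 0 = a 0 \<and> r 1 = a 1) (top_of_set {0..1}) X"
      \<comment> \<open>Functions equal on the unit interval are homotopic, and three homotopies
        chain to the required one; the endpoint condition is common to all of them because 0 and 1
        lie in the interval.\<close>
      have "?H a a'" "?H b b'" using e ends eq maps by (auto intro!: homotopic_with_equal)
      then have "?H a' b'" using ab unfolding path_homotopic_def
        by (blast intro: homotopic_with_trans homotopic_with_symD)
      then show ?thesis unfolding path_homotopic_def e .
    qed
    show "path_homotopic X (\<lambda>t. y \<otimes>\<^bsub>Q\<^esub> a t) (\<lambda>t. y \<otimes>\<^bsub>Q\<^esub> b t)" if "y \<in> carrier Q" for y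
      using homotopic_with_compose_continuous_map_left[OF ab[unfolded path_homotopic_def] cont[OF that],
          of "\<lambda>r. r 0 = y \<otimes>\<^bsub>Q\<^esub> a 0 \<and> r 1 = y \<otimes>\<^bsub>Q\<^esub> a 1"]
      by (simp add: path_homotopic_def o_def)
  qed
qed

section \<open>The quotient by the infinitesimal subgroup\<close>

lemma type_definable_preimage:
  assumes f: "definable_map M m n X Y f" and C: "type_definable \<kappa> M n C"
    and \<kappa>: "Cinfinite \<kappa>" and reg: "regularCard \<kappa>"
  shows "type_definable \<kappa> M m {z \<in> X. f z \<in> C}"
proof -
  obtain \<D> where \<D>: "|\<D>| <o \<kappa>" "\<forall>D\<in>\<D>. definable M n D" "C = cart n \<inter> \<Inter>\<D>"
    using C unfolding type_definable_def by blast
  \<comment> \<open>\<open>cart n\<close> keeps the family nonempty: an empty family of preimages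
    would intersect to all of \<open>cart m\<close> rather than to \<open>X\<close>.\<close>
  let ?\<D> = "(\<lambda>D. {z \<in> X. f z \<in> D}) ` ({cart n} \<union> \<D>)"
  have "|{cart n :: 'a list set}| <o \<kappa>" by (rule finite_ordLess[OF \<kappa> reg]) simp
  then have "|{cart n} \<union> \<D>| <o \<kappa>"
    using \<D>(1) \<kappa> by (intro card_of_Un_ordLess_infinite_Field) (auto simp: cinfinite_def)
  then have "|?\<D>| <o \<kappa>" by (rule ordLeq_ordLess_trans[OF card_of_image])
  moreover have "\<forall>D\<in>?\<D>. definable M m D"
    using \<D>(2) definable_map_preimage[OF f] definable_UNIV by blast
  moreover have "{z \<in> X. f z \<in> C} = cart m \<inter> \<Inter>?\<D>"
    using f \<D>(3) unfolding definable_map_def by auto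
  ultimately show ?thesis unfolding type_definable_def by blast
qed

section \<open>Normality of the infinitesimal subgroup and left translations of the quotient\<close>

context
  fixes \<kappa> :: "'k rel" and M :: "('a::linordered_field, 'f, 'r) expansion" and n and G (structure) and H
  assumes sat: "sufficiently_saturated \<kappa> M" and G: "definable_group M n G"
    and H: "is_G00 \<kappa> M n G H"
begin

text \<open>Every conjugate of \<open>H\<close> is again a type-definable subgroup of bounded index,
  being the preimage of \<open>H\<close> under a definable conjugation and having at most as many
  cosets. Minimality puts \<open>H\<close> inside each conjugate, which is normality.\<close>

lemma normal_G00: "H \<lhd> G"
proof -
  interpret group G using G unfolding definable_group_def by blast
  have \<kappa>: "Cinfinite \<kappa>" "regularCard \<kappa>"
    using sat unfolding sufficiently_saturated_def by auto
  have C: "definable M n (carrier G)" "carrier G \<subseteq> cart n"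
    using G definable_cart[of M n "carrier G"] unfolding definable_group_def by auto
  have sub: "subgroup H G" and td: "type_definable \<kappa> M n H" and idx: "|rcosets H| <o \<kappa>"
    and least: "\<And>K. bounded_type_definable_subgroup \<kappa> M n G K \<Longrightarrow> H \<subseteq> K"
    using H unfolding is_G00_def bounded_type_definable_subgroup_def by auto
  have "H \<subseteq> {h \<in> carrier G. g \<otimes> h \<otimes> inv g \<in> H}" (is "_ \<subseteq> ?K") if g: "g \<in> carrier G" for g
  proof (rule least)
    have "definable_map M n n (carrier G) (carrier G) (\<lambda>h. g \<otimes> h \<otimes> inv g)"
      by (intro definable_map_mult[OF G] definable_map_id definable_map_const C g inv_closed)
    then have "type_definable \<kappa> M n ?K" by (rule type_definable_preimage[OF _ td \<kappa>])
    moreover have "|rcosets ?K| <o \<kappa>"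
      by (rule ordLeq_ordLess_trans[OF card_of_mono1[OF rcosets_conjugate[OF sub g]]
            ordLeq_ordLess_trans[OF card_of_image idx]])
    ultimately show "bounded_type_definable_subgroup \<kappa> M n G ?K"
      using subgroup_conjugate[OF sub g] unfolding bounded_type_definable_subgroup_def by (intro conjI)
  qed
  then have "g \<otimes> h \<otimes> inv g \<in> H" if "g \<in> carrier G" "h \<in> H" for g h using that by blast
  then show ?thesis unfolding normal_inv_iff using sub by (intro conjI ballI)
qed

lemma quotient_proj_hom: "quotient_proj G H \<in> hom G (G Mod H)"
  using normal.r_coset_hom_Mod[OF normal_G00] unfolding quotient_proj_def .

lemma topspace_logic_topology: "topspace (logic_topology \<kappa> M n G H) = carrier (G Mod H)"
proof -
  have "type_definable \<kappa> M n {}"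
    using sat type_definable_if_definable[OF _ _ definable_empty] unfolding sufficiently_saturated_def by blast
  then have "openin (logic_topology \<kappa> M n G H) (carrier (G Mod H))"
    unfolding openin_logic_topology[OF sat G H] by simp
  then show ?thesis using openin_logic_topology[OF sat G H] unfolding topspace_def by blast
qed

text \<open>Closed sets are tested by their preimages in \<open>G\<close>. Multiplication by
  \<open>y\<close> lifts to multiplication by a representative \<open>x\<close>, a definable map of
  \<open>G\<close>, and pulling a type-definable set back along it leaves it type-definable.\<close>

lemma continuous_map_logic_topology_mult:
  assumes "y \<in> carrier (G Mod H)"
  shows "continuous_map (logic_topology \<kappa> M n G H) (logic_topology \<kappa> M n G H)
    (\<lambda>c. y \<otimes>\<^bsub>G Mod H\<^esub> c)"
proof -
  interpret group G using G unfolding definable_group_def by blast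
  interpret Q: group "G Mod H" using normal.factorgroup_is_group[OF normal_G00] .
  have \<kappa>: "Cinfinite \<kappa>" "regularCard \<kappa>"
    using sat unfolding sufficiently_saturated_def by auto
  let ?q = "quotient_proj G H" and ?Q = "carrier (G Mod H)"
  obtain x where x: "x \<in> carrier G" "y = ?q x"
    using assms unfolding carrier_FactGroup quotient_proj_def by blast
  have q: "?q z \<in> ?Q" "?q (x \<otimes> z) = y \<otimes>\<^bsub>G Mod H\<^esub> ?q z" if "z \<in> carrier G" for z
    using that x quotient_proj_hom by (auto simp: hom_def)
  have C: "definable M n (carrier G)" "carrier G \<subseteq> cart n"
    using G definable_cart[of M n "carrier G"] unfolding definable_group_def by auto
  have f: "definable_map M n n (carrier G) (carrier G) (\<lambda>z. x \<otimes> z)"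
    using definable_map_mult[OF G definable_map_const[OF C(1) x(1) C(2)] definable_map_id[OF C(1)]] .
  show ?thesis unfolding continuous_map_def topspace_logic_topology openin_logic_topology[OF sat G H]
  proof (intro conjI funcsetI allI impI)
    fix U assume U: "U \<subseteq> ?Q \<and> type_definable \<kappa> M n {z \<in> carrier G. ?q z \<in> ?Q - U}"
    have "{z \<in> carrier G. ?q z \<in> ?Q - {c \<in> ?Q. y \<otimes>\<^bsub>G Mod H\<^esub> c \<in> U}} =
      {z \<in> carrier G. x \<otimes> z \<in> {z \<in> carrier G. ?q z \<in> ?Q - U}}" using q x(1) by auto
    then show "type_definable \<kappa> M n {z \<in> carrier G. ?q z \<in> ?Q - {c \<in> ?Q. y \<otimes>\<^bsub>G Mod H\<^esub> c \<in> U}}"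
      using type_definable_preimage[OF f conjunct2[OF U] \<kappa>] by simp
  qed (use assms in \<open>auto simp del: mult_FactGroup\<close>)
qed

end

theorem theorem5p2:
  fixes \<kappa> :: "'k rel"
    and M :: "('a::real_closed_field, 'f, 'r) expansion"
    and n :: nat
    and G :: "'a list monoid"
    and T :: "'a list topology"
    and G00 :: "'a list set"
    and tau_star :: "('a \<Rightarrow> 'a list) set \<Rightarrow> (real \<Rightarrow> 'a list set) set"
  assumes "o_minimal M"
    and "sufficiently_saturated \<kappa> M"
    and "definable_group M n G"
    and "group_manifold_topology M n G T"
    and "definably_compact M n G T"
    and "is_G00 \<kappa> M n G G00"
    and "is_tau_star \<kappa> M n G T G00 tau_star"
    and "x \<in> carrier G"
    and "c \<in> arrows (Pi_def M n T)"
  shows "tau_star (translate G (definably_homotopic M n T) x c) =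
    translate (G Mod G00) (path_homotopic (logic_topology \<kappa> M n G G00)) (quotient_proj G G00 x)
      (tau_star c)"
proof -
  note sat = assms(2) and G = assms(3) and T = assms(4) and H = assms(6)
  let ?E = "definably_homotopic M n T" and ?L = "logic_topology \<kappa> M n G G00"
  let ?D = "path_homotopic ?L" and ?Q = "G Mod G00" and ?q = "quotient_proj G G00"
  have Q: "group ?Q" by (rule normal.factorgroup_is_group[OF normal_G00[OF sat G H]])
  note top = topspace_logic_topology[OF sat G H] topspace_carrier[OF G T]
  note cont = continuous_map_logic_topology_mult[OF sat G H]
  note q = quotient_proj_hom[OF sat G H]
  interpret A: path_relation G ?E by (rule path_relation_definably_homotopic[OF G T])
  interpret B: path_relation ?Q ?D by (rule path_relation_path_homotopic[OF Q top(1) cont])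
  have lift: "tau_lift \<kappa> M n G T G00 tau_star"
    and unique: "\<And>F. tau_lift \<kappa> M n G T G00 F \<Longrightarrow> F c = tau_star c"
    using assms(7,9) unfolding is_tau_star_def by auto
  have Pi: "Pi_def M n T = path_groupoid (carrier G) ?E" "Pi_top ?L = path_groupoid (carrier ?Q) ?D"
    unfolding Pi_def_def Pi_top_def top by simp_all
  have F: "groupoid_morphism (Pi_def M n T) (Pi_top ?L) ?q tau_star"
    using lift unfolding tau_lift_def by blast
  define y where "y = ?q x"
  have y: "y \<in> carrier ?Q" using q assms(8) unfolding y_def by (auto simp: hom_def)
  let ?F = "\<lambda>c. translate ?Q ?D (inv\<^bsub>?Q\<^esub> y) (tau_star (translate G ?E x c))"
  have "tau_lift \<kappa> M n G T G00 ?F"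
    unfolding tau_lift_def
  proof (intro conjI allI impI)
    show "groupoid_morphism (Pi_def M n T) (Pi_top ?L) ?q ?F"
      using groupoid_morphism_conjugate[OF A.path_relation_axioms B.path_relation_axioms
          F[unfolded Pi] q assms(8)] unfolding Pi y_def .
  next
    fix U a assume U: "openin ?L U" and a: "definable_path M n T a" and aU: "\<forall>t\<in>{0..1}. ?q (a t) \<in> U"
    have ac: "a t \<in> carrier G" if "t \<in> {0..1}" for t
      using definable_path_in_topspace[OF a that] top by simp
    \<comment> \<open>\<open>V\<close> is the translate of \<open>U\<close> by \<open>y\<close>,
      written as a preimage so that its openness follows from continuity of translation by the
      inverse.\<close>
    define V where "V = {c \<in> carrier ?Q. inv\<^bsub>?Q\<^esub> y \<otimes>\<^bsub>?Q\<^esub> c \<in> U}"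
    have V: "openin ?L V"
      using openin_continuous_map_preimage[OF cont[OF B.inv_closed[OF y]] U] unfolding V_def top .
    have "?q (x \<otimes>\<^bsub>G\<^esub> a t) \<in> V" if t: "t \<in> {0..1}" for t
    proof -
      have qa: "?q (a t) \<in> carrier ?Q" using q ac[OF t] by (auto simp: hom_def)
      have "?q (x \<otimes>\<^bsub>G\<^esub> a t) = y \<otimes>\<^bsub>?Q\<^esub> ?q (a t)" using hom_mult[OF q assms(8) ac[OF t]] unfolding y_def .
      moreover have "inv\<^bsub>?Q\<^esub> y \<otimes>\<^bsub>?Q\<^esub> (y \<otimes>\<^bsub>?Q\<^esub> ?q (a t)) = ?q (a t)"
        using y qa B.m_assoc[of "inv\<^bsub>?Q\<^esub> y" y "?q (a t)"] B.l_inv B.l_one by (metis B.inv_closed)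
      ultimately show ?thesis using aU t B.m_closed[OF y qa] unfolding V_def by simp
    qed
    then obtain b where b: "pathin ?L b" "b ` {0..1} \<subseteq> V"
        "tau_star (path_class ?E (\<lambda>t. x \<otimes>\<^bsub>G\<^esub> a t)) = path_class ?D b"
      using lift V definable_path_mult_left[OF G T a assms(8)] unfolding tau_lift_def by blast
    have bc: "b t \<in> carrier ?Q" if "t \<in> {0..1}" for t using b(2) that unfolding V_def by blast
    \<comment> \<open>The path \<open>b\<close> represents the image of the translate of
      \<open>a\<close> and stays in \<open>V\<close>; moved back by the inverse of \<open>y\<close>,
      it stays in \<open>U\<close> and represents the image of \<open>a\<close> under the
      conjugate.\<close>
    have "?F (path_class ?E a) = path_class ?D (\<lambda>t. inv\<^bsub>?Q\<^esub> y \<otimes>\<^bsub>?Q\<^esub> b t)"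
      using A.translate_path_class[OF assms(8) ac] B.translate_path_class[OF B.inv_closed[OF y] bc] b(3)
      by simp
    moreover have "pathin ?L (\<lambda>t. inv\<^bsub>?Q\<^esub> y \<otimes>\<^bsub>?Q\<^esub> b t)"
      using continuous_map_compose[OF b(1)[unfolded pathin_def] cont[OF B.inv_closed[OF y]]]
      unfolding pathin_def o_def .
    moreover have "(\<lambda>t. inv\<^bsub>?Q\<^esub> y \<otimes>\<^bsub>?Q\<^esub> b t) ` {0..1} \<subseteq> U"
      using b(2) unfolding V_def by blast
    ultimately show "\<exists>b. pathin ?L b \<and> b ` {0..1} \<subseteq> U \<and> ?F (path_class ?E a) = path_class ?D b"
      by blast
  qed
  then have "tau_star c = ?F c" using unique by simp
  \<comment> \<open>Translating \<open>tau_star c = ?F c\<close> by \<open>y\<close> removes the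
    outer translation. The cancellation lemma speaks of arrows, so \<open>tau_star\<close> must be
    seen to send the translate of \<open>c\<close> to an arrow.\<close>
  moreover have "translate ?Q ?D y (?F c) = tau_star (translate G ?E x c)"
  proof (rule B.translate_inv_translate[OF _ y])
    show "tau_star (translate G ?E x c) \<in> arrows (path_groupoid (carrier ?Q) ?D)"
      using F A.translate_arrow[OF assms(9)[unfolded Pi] assms(8)]
      unfolding groupoid_morphism_def Pi by blast
  qed
  ultimately show ?thesis unfolding y_def by simp
qed

end
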